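(* Let $\mathcal A$ be an abelian category with enough projectives, and let $\mathcal F$ be a special precover class in $\mathcal A$. Then $\mathcal F$ defines a homological dimension if and only if $\mathcal F={}^{\perp_\infty}(\mathcal F^{\perp_\infty})$.
   Context: Here $\mathbb N$ includes $0$. For a class $\mathcal G$ of objects and $m\ge1$, $\mathcal G^{\perp_m}=\{M\in\mathcal A:\operatorname{Ext}^i_{\mathcal A}(G,M)=0\ \forall\,1\le i\le m,\ G\in\mathcal G\}$ and ${}^{\perp_m}\mathcal G=\{M\in\mathcal A:\operatorname{Ext}^i_{\mathcal A}(M,G)=0\ \forall\,1\le i\le m,\ G\in\mathcal G\}$; moreover $\mathcal G^{\perp_\infty}=\bigcap_{m\ge1}\mathcal G^{\perp_m}$ and ${}^{\perp_\infty}\mathcal G=\bigcap_{m\ge1}{}^{\perp_m}\mathcal G$. A special precover class is a class $\mathcal F$ of objects, closed under isomorphisms and direct summands, such that every object $M$ of $\mathcal A$ has a special $\mathcal F$-precover, i.e. there is a short exact sequence $0\to K\to F\to M\to 0$ with $F\in\mathcal F$ and $K\in\mathcal F^{\perp_1}$. For $\alpha\in\mathbb N\cup\{\infty\}$, $\mathcal F_\alpha$ is the class of objects $M$ of $\mathcal A$ for which there is a long exact sequence $\cdots\to F_i\to F_{i-1}\to\cdots\to F_1\to F_0\to M\to 0$ with each $F_i\in\mathcal F\cup\{0\}$ and $F_i=0$ for $i>\alpha$. The class $\mathcal F$ defines a homological dimension if: (1) for any short exact sequence $0\to K\to F\to M\to 0$ with $F\in\mathcal F$ and $M\in\mathcal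 F_\infty$, the object $K$ belongs to $\mathcal F_\infty$; and (2) for every $n\in\mathbb N$ and any exact sequence $0\to K_n\to F_{n-1}\to\cdots\to F_1\to F_0\to X\to 0$ with $F_i\in\mathcal F$ for $i=0,\dots,n-1$ and $X\in\mathcal F_n$, the object $K_n$ belongs to $\mathcal F$. *)

theory Defs
  imports "HOL-Algebra.Elementary_Groups" "HOL-Library.Extended_Nat"
begin

section \<open>Abelian categories\<close>

text \<open>
  Objects and arrows are elements of two arbitrary types; a class of objects is a set of
  objects. Composition and addition are only meaningful on composable, respectively parallel,
  arrows.
\<close>

record ('o, 'm) preadd_cat =
  Obj :: "'o set"
  Arr :: "'m set"
  Dom :: "'m \<Rightarrow> 'o"
  Cod :: "'m \<Rightarrow> 'o"
  Idt :: "'o \<Rightarrow> 'm"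
  Cmp :: "'m \<Rightarrow> 'm \<Rightarrow> 'm"  (infixr "\<cdot>\<index>" 70)
  Add :: "'m \<Rightarrow> 'm \<Rightarrow> 'm"
  Zer :: "'o \<Rightarrow> 'o \<Rightarrow> 'm"

definition Hom :: "('o, 'm) preadd_cat \<Rightarrow> 'o \<Rightarrow> 'o \<Rightarrow> 'm set" where
  "Hom C A B = {f \<in> Arr C. Dom C f = A \<and> Cod C f = B}"

definition hom_group :: "('o, 'm) preadd_cat \<Rightarrow> 'o \<Rightarrow> 'o \<Rightarrow> 'm monoid" where
  "hom_group C A B = \<lparr>carrier = Hom C A B, monoid.mult = Add C, one = Zer C A B\<rparr>"

locale preadditive_category =
  fixes C :: "('o, 'm) preadd_cat" (structure)
  assumes Dom_in_Obj: "f \<in> Arr C \<Longrightarrow> Dom C f \<in> Obj C"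
    and Cod_in_Obj: "f \<in> Arr C \<Longrightarrow> Cod C f \<in> Obj C"
    and Idt_in_Hom: "A \<in> Obj C \<Longrightarrow> Idt C A \<in> Hom C A A"
    and Cmp_in_Hom: "f \<in> Hom C A B \<Longrightarrow> g \<in> Hom C B D \<Longrightarrow> g \<cdot> f \<in> Hom C A D"
    and Cmp_assoc: "f \<in> Hom C A B \<Longrightarrow> g \<in> Hom C B D \<Longrightarrow> h \<in> Hom C D E \<Longrightarrow>
      (h \<cdot> g) \<cdot> f = h \<cdot> (g \<cdot> f)"
    and Cmp_Idt_left: "f \<in> Hom C A B \<Longrightarrow> Idt C B \<cdot> f = f"
    and Cmp_Idt_right: "f \<in> Hom C A B \<Longrightarrow> f \<cdot> Idt C A = f"
    and hom_comm_group: "A \<in> Obj C \<Longrightarrow> B \<in> Obj C \<Longrightarrow> comm_group (hom_group C A B)"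
    and Cmp_Add_left: "f \<in> Hom C A B \<Longrightarrow> g \<in> Hom C B D \<Longrightarrow> g' \<in> Hom C B D \<Longrightarrow>
      Add C g g' \<cdot> f = Add C (g \<cdot> f) (g' \<cdot> f)"
    and Cmp_Add_right: "f \<in> Hom C A B \<Longrightarrow> f' \<in> Hom C A B \<Longrightarrow> g \<in> Hom C B D \<Longrightarrow>
      g \<cdot> Add C f f' = Add C (g \<cdot> f) (g \<cdot> f')"

definition zero_object :: "('o, 'm) preadd_cat \<Rightarrow> 'o \<Rightarrow> bool" where
  "zero_object C Z \<longleftrightarrow> Z \<in> Obj C \<and>
     (\<forall>A \<in> Obj C. (\<exists>!f. f \<in> Hom C A Z) \<and> (\<exists>!f. f \<in> Hom C Z A))"

definition monic :: "('o, 'm) preadd_cat \<Rightarrow> 'm \<Rightarrow> bool" where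
  "monic C f \<longleftrightarrow> f \<in> Arr C \<and>
     (\<forall>A. \<forall>g \<in> Hom C A (Dom C f). \<forall>h \<in> Hom C A (Dom C f).
        f \<cdot>\<^bsub>C\<^esub> g = f \<cdot>\<^bsub>C\<^esub> h \<longrightarrow> g = h)"

definition epic :: "('o, 'm) preadd_cat \<Rightarrow> 'm \<Rightarrow> bool" where
  "epic C f \<longleftrightarrow> f \<in> Arr C \<and>
     (\<forall>B. \<forall>g \<in> Hom C (Cod C f) B. \<forall>h \<in> Hom C (Cod C f) B.
        g \<cdot>\<^bsub>C\<^esub> f = h \<cdot>\<^bsub>C\<^esub> f \<longrightarrow> g = h)"

definition isomorphic :: "('o, 'm) preadd_cat \<Rightarrow> 'o \<Rightarrow> 'o \<Rightarrow> bool" where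
  "isomorphic C A B \<longleftrightarrow> A \<in> Obj C \<and> B \<in> Obj C \<and>
     (\<exists>f \<in> Hom C A B. \<exists>g \<in> Hom C B A. g \<cdot>\<^bsub>C\<^esub> f = Idt C A \<and> f \<cdot>\<^bsub>C\<^esub> g = Idt C B)"

definition is_kernel :: "('o, 'm) preadd_cat \<Rightarrow> 'm \<Rightarrow> 'm \<Rightarrow> bool" where
  "is_kernel C k f \<longleftrightarrow> k \<in> Arr C \<and> f \<in> Arr C \<and> Cod C k = Dom C f \<and>
     f \<cdot>\<^bsub>C\<^esub> k = Zer C (Dom C k) (Cod C f) \<and>
     (\<forall>A \<in> Obj C. \<forall>g \<in> Hom C A (Dom C f). f \<cdot>\<^bsub>C\<^esub> g = Zer C A (Cod C f) \<longrightarrow>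
        (\<exists>!h. h \<in> Hom C A (Dom C k) \<and> k \<cdot>\<^bsub>C\<^esub> h = g))"

definition is_cokernel :: "('o, 'm) preadd_cat \<Rightarrow> 'm \<Rightarrow> 'm \<Rightarrow> bool" where
  "is_cokernel C c f \<longleftrightarrow> c \<in> Arr C \<and> f \<in> Arr C \<and> Dom C c = Cod C f \<and>
     c \<cdot>\<^bsub>C\<^esub> f = Zer C (Dom C f) (Cod C c) \<and>
     (\<forall>B \<in> Obj C. \<forall>g \<in> Hom C (Cod C f) B. g \<cdot>\<^bsub>C\<^esub> f = Zer C (Dom C f) B \<longrightarrow>
        (\<exists>!h. h \<in> Hom C (Cod C c) B \<and> h \<cdot>\<^bsub>C\<^esub> c = g))"

definition biproduct :: "('o, 'm) preadd_cat \<Rightarrow> 'o \<Rightarrow> 'o \<Rightarrow> 'o \<Rightarrow> bool" where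
  "biproduct C A B S \<longleftrightarrow> A \<in> Obj C \<and> B \<in> Obj C \<and> S \<in> Obj C \<and>
     (\<exists>i \<in> Hom C A S. \<exists>j \<in> Hom C B S. \<exists>p \<in> Hom C S A. \<exists>q \<in> Hom C S B.
        p \<cdot>\<^bsub>C\<^esub> i = Idt C A \<and> q \<cdot>\<^bsub>C\<^esub> j = Idt C B \<and>
        p \<cdot>\<^bsub>C\<^esub> j = Zer C B A \<and> q \<cdot>\<^bsub>C\<^esub> i = Zer C A B \<and>
        Add C (i \<cdot>\<^bsub>C\<^esub> p) (j \<cdot>\<^bsub>C\<^esub> q) = Idt C S)"

locale abelian_category = preadditive_category +
  assumes has_zero_object: "\<exists>Z. zero_object C Z"
    and has_biproduct: "A \<in> Obj C \<Longrightarrow> B \<in> Obj C \<Longrightarrow> \<exists>S. biproduct C A B S"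
    and has_kernel: "f \<in> Arr C \<Longrightarrow> \<exists>k. is_kernel C k f"
    and has_cokernel: "f \<in> Arr C \<Longrightarrow> \<exists>c. is_cokernel C c f"
    and monic_is_kernel: "monic C m \<Longrightarrow> \<exists>f. is_kernel C m f"
    and epic_is_cokernel: "epic C e \<Longrightarrow> \<exists>f. is_cokernel C e f"

definition projective :: "('o, 'm) preadd_cat \<Rightarrow> 'o \<Rightarrow> bool" where
  "projective C P \<longleftrightarrow> P \<in> Obj C \<and>
     (\<forall>e. epic C e \<longrightarrow>
        (\<forall>f \<in> Hom C P (Cod C e). \<exists>g \<in> Hom C P (Dom C e). e \<cdot>\<^bsub>C\<^esub> g = f))"

definition enough_projectives :: "('o, 'm) preadd_cat \<Rightarrow> bool" where
  "enough_projectives C \<longleftrightarrow>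
     (\<forall>A \<in> Obj C. \<exists>P. projective C P \<and> (\<exists>e \<in> Hom C P A. epic C e))"


section \<open>Exact sequences\<close>

text \<open>The image of an arrow is the kernel of its cokernel.\<close>

definition is_image :: "('o, 'm) preadd_cat \<Rightarrow> 'm \<Rightarrow> 'm \<Rightarrow> bool" where
  "is_image C m f \<longleftrightarrow> (\<exists>c. is_cokernel C c f \<and> is_kernel C m c)"

definition exact_at :: "('o, 'm) preadd_cat \<Rightarrow> 'm \<Rightarrow> 'm \<Rightarrow> bool" where
  "exact_at C f g \<longleftrightarrow> Cod C f = Dom C g \<and> (\<exists>m. is_image C m f \<and> is_kernel C m g)"

definition short_exact ::
  "('o, 'm) preadd_cat \<Rightarrow> 'o \<Rightarrow> 'm \<Rightarrow> 'o \<Rightarrow> 'm \<Rightarrow> 'o \<Rightarrow> bool" where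
  "short_exact C K i F p M \<longleftrightarrow>
     i \<in> Hom C K F \<and> p \<in> Hom C F M \<and> monic C i \<and> exact_at C i p \<and> epic C p"

text \<open>
  \<open>exact_left C X d M\<close>: the sequence \<open>\<dots> \<rightarrow> X 1 \<rightarrow> X 0 \<rightarrow> M \<rightarrow> 0\<close> is exact, with augmentation
  \<open>d 0 : X 0 \<rightarrow> M\<close> and differentials \<open>d (Suc i) : X (Suc i) \<rightarrow> X i\<close>.
\<close>

definition exact_left ::
  "('o, 'm) preadd_cat \<Rightarrow> (nat \<Rightarrow> 'o) \<Rightarrow> (nat \<Rightarrow> 'm) \<Rightarrow> 'o \<Rightarrow> bool" where
  "exact_left C X d M \<longleftrightarrow>
     d 0 \<in> Hom C (X 0) M \<and> (\<forall>i. d (Suc i) \<in> Hom C (X (Suc i)) (X i)) \<and>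
     epic C (d 0) \<and> (\<forall>i. exact_at C (d (Suc i)) (d i))"

text \<open>
  \<open>exact_chain C n Y d\<close>: the sequence \<open>0 \<rightarrow> Y (n + 1) \<rightarrow> Y n \<rightarrow> \<dots> \<rightarrow> Y 1 \<rightarrow> Y 0 \<rightarrow> 0\<close> is exact,
  with \<open>d i : Y (i + 1) \<rightarrow> Y i\<close>. For \<open>n = 0\<close> it says that \<open>d 0\<close> is monic and epic.
\<close>

definition exact_chain ::
  "('o, 'm) preadd_cat \<Rightarrow> nat \<Rightarrow> (nat \<Rightarrow> 'o) \<Rightarrow> (nat \<Rightarrow> 'm) \<Rightarrow> bool" where
  "exact_chain C n Y d \<longleftrightarrow>
     (\<forall>i \<le> n. d i \<in> Hom C (Y (Suc i)) (Y i)) \<and>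
     monic C (d n) \<and> (\<forall>i < n. exact_at C (d (Suc i)) (d i)) \<and> epic C (d 0)"


section \<open>Ext groups\<close>

text \<open>
  Ext is the right derived functor of Hom, computed in a category with enough projectives
  from a chosen projective resolution of the first argument; up to isomorphism the choice is
  irrelevant.
\<close>

definition projective_resolution ::
  "('o, 'm) preadd_cat \<Rightarrow> 'o \<Rightarrow> (nat \<Rightarrow> 'o) \<times> (nat \<Rightarrow> 'm) \<Rightarrow> bool" where
  "projective_resolution C G R \<longleftrightarrow>
     exact_left C (fst R) (snd R) G \<and> (\<forall>i. projective C (fst R i))"

definition chosen_resolution ::
  "('o, 'm) preadd_cat \<Rightarrow> 'o \<Rightarrow> (nat \<Rightarrow> 'o) \<times> (nat \<Rightarrow> 'm)" where
  "chosen_resolution C G = (SOME R. projective_resolution C G R)"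

text \<open>
  Cocycles and coboundaries in degree \<open>i\<close> of the complex \<open>Hom (X 0) M \<rightarrow> Hom (X 1) M \<rightarrow> \<dots>\<close>;
  the augmentation \<open>d 0\<close> is not part of it.
\<close>

definition cocycles ::
  "('o, 'm) preadd_cat \<Rightarrow> (nat \<Rightarrow> 'o) \<times> (nat \<Rightarrow> 'm) \<Rightarrow> 'o \<Rightarrow> nat \<Rightarrow> 'm set" where
  "cocycles C R M i = (case R of (X, d) \<Rightarrow>
     kernel (hom_group C (X i) M) (hom_group C (X (Suc i)) M) (\<lambda>f. f \<cdot>\<^bsub>C\<^esub> d (Suc i)))"

definition coboundaries ::
  "('o, 'm) preadd_cat \<Rightarrow> (nat \<Rightarrow> 'o) \<times> (nat \<Rightarrow> 'm) \<Rightarrow> 'o \<Rightarrow> nat \<Rightarrow> 'm set" where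
  "coboundaries C R M i = (case R of (X, d) \<Rightarrow> (case i of
       0 \<Rightarrow> {Zer C (X 0) M}
     | Suc j \<Rightarrow> (\<lambda>f. f \<cdot>\<^bsub>C\<^esub> d (Suc j)) ` Hom C (X j) M))"

definition Ext :: "('o, 'm) preadd_cat \<Rightarrow> nat \<Rightarrow> 'o \<Rightarrow> 'o \<Rightarrow> 'm set monoid" where
  "Ext C i G M = (let R = chosen_resolution C G in
     (hom_group C (fst R i) M)\<lparr>carrier := cocycles C R M i\<rparr> Mod coboundaries C R M i)"


section \<open>Ext-orthogonal classes and homological dimensions\<close>

definition right_perp :: "('o, 'm) preadd_cat \<Rightarrow> nat \<Rightarrow> 'o set \<Rightarrow> 'o set" where
  "right_perp C m \<G> =
     {M \<in> Obj C. \<forall>i. 1 \<le> i \<and> i \<le> m \<longrightarrow> (\<forall>G \<in> \<G>. trivial_group (Ext C i G M))}"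

definition left_perp :: "('o, 'm) preadd_cat \<Rightarrow> nat \<Rightarrow> 'o set \<Rightarrow> 'o set" where
  "left_perp C m \<G> =
     {M \<in> Obj C. \<forall>i. 1 \<le> i \<and> i \<le> m \<longrightarrow> (\<forall>G \<in> \<G>. trivial_group (Ext C i M G))}"

definition right_perp_inf :: "('o, 'm) preadd_cat \<Rightarrow> 'o set \<Rightarrow> 'o set" where
  "right_perp_inf C \<G> = (\<Inter>m \<in> {1..}. right_perp C m \<G>)"

definition left_perp_inf :: "('o, 'm) preadd_cat \<Rightarrow> 'o set \<Rightarrow> 'o set" where
  "left_perp_inf C \<G> = (\<Inter>m \<in> {1..}. left_perp C m \<G>)"

definition special_precover_class :: "('o, 'm) preadd_cat \<Rightarrow> 'o set \<Rightarrow> bool" where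
  "special_precover_class C \<F> \<longleftrightarrow> \<F> \<subseteq> Obj C \<and>
     (\<forall>A B. A \<in> \<F> \<and> isomorphic C A B \<longrightarrow> B \<in> \<F>) \<and>
     (\<forall>A B S. S \<in> \<F> \<and> biproduct C A B S \<longrightarrow> A \<in> \<F>) \<and>
     (\<forall>M \<in> Obj C. \<exists>K i F p. short_exact C K i F p M \<and> F \<in> \<F> \<and> K \<in> right_perp C 1 \<F>)"

definition resolved_class :: "('o, 'm) preadd_cat \<Rightarrow> 'o set \<Rightarrow> enat \<Rightarrow> 'o set" where
  "resolved_class C \<F> \<alpha> = {M \<in> Obj C. \<exists>X d. exact_left C X d M \<and>
     (\<forall>i. X i \<in> \<F> \<or> zero_object C (X i)) \<and>
     (\<forall>i. enat i > \<alpha> \<longrightarrow> zero_object C (X i))}"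

definition defines_homological_dimension :: "('o, 'm) preadd_cat \<Rightarrow> 'o set \<Rightarrow> bool" where
  "defines_homological_dimension C \<F> \<longleftrightarrow>
     (\<forall>K i F p M. short_exact C K i F p M \<and> F \<in> \<F> \<and> M \<in> resolved_class C \<F> \<infinity> \<longrightarrow>
        K \<in> resolved_class C \<F> \<infinity>) \<and>
     (\<forall>n Y d. exact_chain C n Y d \<and> (\<forall>i < n. Y (Suc i) \<in> \<F>) \<and>
        Y 0 \<in> resolved_class C \<F> (enat n) \<longrightarrow> Y (Suc n) \<in> \<F>)"

end

theory Submission
  imports Defs
begin

text \<open>
  Everything is reduced to the vanishing of the groups \<open>Ext\<^sup>i(G, M)\<close>, and vanishing is studied
  without the groups themselves. \<open>Ext\<^sup>1(G, M) = 0\<close> says that for every short exact sequence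
  \<open>0 \<rightarrow> K \<rightarrow> B \<rightarrow> G \<rightarrow> 0\<close> each arrow \<open>K \<rightarrow> M\<close> extends to \<open>B\<close>, and \<open>Ext\<^sup>i\<^sup>+\<^sup>1(G, M) = 0\<close> says that
  \<open>Ext\<^sup>i(K, M) = 0\<close> for each syzygy \<open>K\<close> of \<open>G\<close>, the kernel of an epimorphism from a projective object
  onto \<open>G\<close>. The recursive predicate \<open>ext_vanishes C n G M\<close> expresses \<open>Ext\<^sup>n\<^sup>+\<^sup>1(G, M) = 0\<close> in this way.
  That one syzygy may stand for all of them is the lemma \<open>ext_vanishes_Suc_iff\<close>; the agreement with
  the cohomology of a chosen projective resolution is \<open>trivial_Ext_iff_ext_vanishes\<close>. The parts of
  the long exact sequence that concern vanishing (\<open>ext_vanishes_middle\<close>, \<open>ext_vanishes_quotient\<close>,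
  \<open>ext_vanishes_sub\<close>) follow from the horseshoe lemma.

  Let \<open>\<F>\<close> be a special precover class. If \<open>Ext\<^sup>1(M, K) = 0\<close> for all \<open>K \<in> \<F>\<^sup>\<bottom>\<^sup>1\<close>, then a special
  precover \<open>0 \<rightarrow> K \<rightarrow> F \<rightarrow> M \<rightarrow> 0\<close> splits, so \<open>M\<close> is a summand of \<open>F\<close> and lies in \<open>\<F>\<close>
  (\<open>special_precover_class_member\<close>). In particular \<open>\<F>\<close> contains the projective objects, every object
  has a resolution by members of \<open>\<F>\<close>, and the first condition of a homological dimension
  follows.

  Suppose that \<open>\<F>\<close> is its own double orthogonal, and let \<open>M \<in> \<F>\<^sup>\<bottom>\<^sup>\<infinity>\<close>. The members of \<open>\<F>\<close> are
  then acyclic for \<open>Ext(-, M)\<close>. For \<open>X\<close> with an \<open>\<F>\<close>-resolution of length \<open>n\<close>, dimension shifting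
  along the resolution gives \<open>Ext\<^sup>i(X, M) = 0\<close> for \<open>i > n\<close>, and shifting back along any exact sequence
  \<open>0 \<rightarrow> K \<rightarrow> F\<^sub>n\<^sub>-\<^sub>1 \<rightarrow> \<dots> \<rightarrow> F\<^sub>0 \<rightarrow> X \<rightarrow> 0\<close> gives \<open>Ext\<^sup>i(K, M) = 0\<close> for \<open>i > 0\<close>. As \<open>M\<close> was
  arbitrary, \<open>K\<close> belongs to the double orthogonal, which is \<open>\<F>\<close>; this is the second condition.

  Conversely, the second condition for \<open>0 \<rightarrow> K \<rightarrow> P \<rightarrow> G \<rightarrow> 0\<close> with \<open>G \<in> \<F>\<close> and \<open>P\<close> projective says that
  \<open>\<F>\<close> contains the syzygies of its members. By dimension shifting \<open>\<F>\<^sup>\<bottom>\<^sup>1 = \<F>\<^sup>\<bottom>\<^sup>\<infinity>\<close>, so an object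
  \<open>M\<close> of the double orthogonal satisfies \<open>Ext\<^sup>1(M, N) = 0\<close> for all \<open>N \<in> \<F>\<^sup>\<bottom>\<^sup>1\<close>, and the splitting
  argument puts it into \<open>\<F>\<close>.
\<close>


section \<open>Arrows of a preadditive category\<close>

context preadditive_category
begin

text \<open>
  The membership of the two objects follows from the rest of the right-hand side. It is included
  because the rules about zero arrows and identities have it as a premise, so that the simplifier
  finds it among the hypotheses.
\<close>

lemma Hom_iff:
  "f \<in> Hom C A B \<longleftrightarrow> f \<in> Arr C \<and> Dom C f = A \<and> Cod C f = B \<and> A \<in> Obj C \<and> B \<in> Obj C"
  using Dom_in_Obj Cod_in_Obj by (auto simp: Hom_def)

declare Dom_in_Obj [simp] Cod_in_Obj [simp]

lemma Hom_Obj: "f \<in> Hom C A B \<Longrightarrow> A \<in> Obj C" "f \<in> Hom C A B \<Longrightarrow> B \<in> Obj C"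
  using Dom_in_Obj Cod_in_Obj by (auto simp: Hom_iff)

lemma Cmp_arr:
  assumes "f \<in> Arr C" "g \<in> Arr C" "Dom C g = Cod C f"
  shows "g \<cdot> f \<in> Arr C" "Dom C (g \<cdot> f) = Dom C f" "Cod C (g \<cdot> f) = Cod C g"
  using Cmp_in_Hom[of f "Dom C f" "Cod C f" g "Cod C g"] assms by (auto simp: Hom_iff)

lemma Cmp_assoc': "\<lbrakk>f \<in> Arr C; g \<in> Arr C; h \<in> Arr C; Dom C g = Cod C f; Dom C h = Cod C g\<rbrakk>
  \<Longrightarrow> (h \<cdot> g) \<cdot> f = h \<cdot> (g \<cdot> f)"
  using Cmp_assoc[of f "Dom C f" "Cod C f" g "Cod C g" h "Cod C h"] by (auto simp: Hom_iff)

lemma Idt_arr: "A \<in> Obj C \<Longrightarrow> Idt C A \<in> Arr C" "A \<in> Obj C \<Longrightarrow> Dom C (Idt C A) = A"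
  "A \<in> Obj C \<Longrightarrow> Cod C (Idt C A) = A"
  using Idt_in_Hom[of A] by (auto simp: Hom_iff)

lemma Cmp_Idt:
  "f \<in> Arr C \<Longrightarrow> Cod C f = B \<Longrightarrow> Idt C B \<cdot> f = f"
  "f \<in> Arr C \<Longrightarrow> Dom C f = A \<Longrightarrow> f \<cdot> Idt C A = f"
  using Cmp_Idt_left Cmp_Idt_right by (auto simp: Hom_iff)

lemma hom_group_simps:
  "carrier (hom_group C A B) = Hom C A B" "monoid.mult (hom_group C A B) = Add C"
  "one (hom_group C A B) = Zer C A B"
  by (simp_all add: hom_group_def)

lemma Zer_in_Hom: "A \<in> Obj C \<Longrightarrow> B \<in> Obj C \<Longrightarrow> Zer C A B \<in> Hom C A B"
  using monoid.one_closed[OF group.is_monoid[OF comm_group.axioms(2)[OF hom_comm_group]]]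
  by (simp add: hom_group_simps)

lemma Zer_arr:
  assumes "A \<in> Obj C" "B \<in> Obj C"
  shows "Zer C A B \<in> Arr C" "Dom C (Zer C A B) = A" "Cod C (Zer C A B) = B"
  using Zer_in_Hom[OF assms] by (auto simp: Hom_iff)

lemma Add_in_Hom: "f \<in> Hom C A B \<Longrightarrow> g \<in> Hom C A B \<Longrightarrow> Add C f g \<in> Hom C A B"
  using monoid.m_closed[OF group.is_monoid[OF comm_group.axioms(2)[OF hom_comm_group[of A B]]]]
  by (simp add: hom_group_simps Hom_Obj)

lemma Add_arr:
  assumes "f \<in> Arr C" "g \<in> Arr C" "Dom C g = Dom C f" "Cod C g = Cod C f"
  shows "Add C f g \<in> Arr C" "Dom C (Add C f g) = Dom C f" "Cod C (Add C f g) = Cod C f"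
  using Add_in_Hom[of f "Dom C f" "Cod C f" g] assms by (auto simp: Hom_iff)

lemma Add_Zer:
  "\<lbrakk>f \<in> Arr C; A = Dom C f; B = Cod C f\<rbrakk> \<Longrightarrow> Add C f (Zer C A B) = f"
  "\<lbrakk>f \<in> Arr C; A = Dom C f; B = Cod C f\<rbrakk> \<Longrightarrow> Add C (Zer C A B) f = f"
  using comm_group.axioms(2)[OF hom_comm_group[of A B]] group.is_monoid
  monoid.r_one[of "hom_group C A B" f] monoid.l_one[of "hom_group C A B" f]
  by (auto simp: hom_group_simps Hom_iff)

lemma Add_commute:
  "\<lbrakk>f \<in> Arr C; g \<in> Arr C; Dom C g = Dom C f; Cod C g = Cod C f\<rbrakk> \<Longrightarrow> Add C f g = Add C g f"
  using hom_comm_group[of "Dom C f" "Cod C f"]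
    comm_monoid.m_comm[of "hom_group C (Dom C f) (Cod C f)" f g]
  by (auto simp: hom_group_simps Hom_iff Dom_in_Obj Cod_in_Obj comm_group_def)

lemma Add_cancel:
  assumes "f \<in> Hom C A B" "g \<in> Hom C A B" "h \<in> Hom C A B" "Add C f g = Add C f h"
  shows "g = h"
proof -
  interpret G: comm_group "hom_group C A B" using assms hom_comm_group Hom_Obj by blast
  show ?thesis using G.Units_l_cancel[of f g h] assms by (simp add: G.Units_eq hom_group_simps)
qed

lemma Add_cancel_Zer:
  "\<lbrakk>f \<in> Hom C A B; g \<in> Hom C A B; Add C f g = f\<rbrakk> \<Longrightarrow> g = Zer C A B"
  using Add_cancel[of f A B g "Zer C A B"] by (simp add: Add_Zer Zer_in_Hom Hom_Obj) (simp add: Add_Zer Hom_iff)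

text \<open>
  Differences are used only through this existence statement: no subtraction is introduced, and
  all calculations need just the distributivity of composition over \<open>Add\<close>.
\<close>

lemma exists_difference:
  assumes "f \<in> Hom C A B" "g \<in> Hom C A B" shows "\<exists>h \<in> Hom C A B. Add C g h = f"
proof -
  interpret G: comm_group "hom_group C A B" using assms hom_comm_group Hom_Obj by blast
  have i: "inv\<^bsub>hom_group C A B\<^esub> g \<in> Hom C A B"
    using G.inv_closed[of g] assms by (simp add: hom_group_simps(1))
  have "f = g \<otimes>\<^bsub>hom_group C A B\<^esub> (inv\<^bsub>hom_group C A B\<^esub> g \<otimes>\<^bsub>hom_group C A B\<^esub> f)"
    using assms i G.m_assoc[of g "inv\<^bsub>hom_group C A B\<^esub> g" f] G.r_inv[of g] G.l_one[of f]
    by (simp add: hom_group_simps(1))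
  moreover have "inv\<^bsub>hom_group C A B\<^esub> g \<otimes>\<^bsub>hom_group C A B\<^esub> f \<in> Hom C A B"
    using Add_in_Hom[OF i assms(1)] by (simp add: hom_group_simps(2))
  ultimately show ?thesis unfolding hom_group_simps by metis
qed

lemma Cmp_Add:
  "\<lbrakk>f \<in> Arr C; g \<in> Arr C; g' \<in> Arr C; Cod C f = Dom C g; Dom C g' = Dom C g; Cod C g' = Cod C g\<rbrakk>
    \<Longrightarrow> Add C g g' \<cdot> f = Add C (g \<cdot> f) (g' \<cdot> f)"
  "\<lbrakk>f \<in> Arr C; f' \<in> Arr C; g \<in> Arr C; Dom C g = Cod C f; Dom C f' = Dom C f; Cod C f' = Cod C f\<rbrakk>
    \<Longrightarrow> g \<cdot> Add C f f' = Add C (g \<cdot> f) (g \<cdot> f')"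
  using Cmp_Add_left[of f "Dom C f" "Dom C g" g "Cod C g" g']
    Cmp_Add_right[of f "Dom C f" "Dom C g" f' g "Cod C g"]
  by (auto simp: Hom_iff)

lemma Cmp_Zer_right:
  assumes "g \<in> Arr C" "Dom C g = B" "A \<in> Obj C"
  shows "g \<cdot> Zer C A B = Zer C A (Cod C g)"
proof -
  have B: "B \<in> Obj C" using assms Dom_in_Obj by auto
  have h: "g \<cdot> Zer C A B \<in> Hom C A (Cod C g)"
    using assms B by (simp add: Hom_iff Cmp_arr Zer_arr)
  have "Add C (g \<cdot> Zer C A B) (g \<cdot> Zer C A B) = g \<cdot> Add C (Zer C A B) (Zer C A B)"
    using assms B by (simp add: Cmp_Add Zer_arr)
  also have "\<dots> = g \<cdot> Zer C A B" using assms B by (simp add: Add_Zer Zer_arr)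
  finally show ?thesis using Add_cancel_Zer[OF h h] by simp
qed

lemma Cmp_Zer_left:
  assumes "f \<in> Arr C" "Cod C f = B" "D \<in> Obj C"
  shows "Zer C B D \<cdot> f = Zer C (Dom C f) D"
proof -
  have B: "B \<in> Obj C" using assms Cod_in_Obj by auto
  have h: "Zer C B D \<cdot> f \<in> Hom C (Dom C f) D"
    using assms B by (simp add: Hom_iff Cmp_arr Zer_arr)
  have "Add C (Zer C B D \<cdot> f) (Zer C B D \<cdot> f) = Add C (Zer C B D) (Zer C B D) \<cdot> f"
    using assms B by (simp add: Cmp_Add Zer_arr)
  also have "\<dots> = Zer C B D \<cdot> f" using assms B by (simp add: Add_Zer Zer_arr)
  finally show ?thesis using Add_cancel_Zer[OF h h] by simp
qed

text \<open>
  These rules type-check composites by computing \<open>Dom\<close> and \<open>Cod\<close>, push composition inside sums and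
  bracket composites to the right.
\<close>

lemmas arrow_simps = Hom_iff Cmp_arr Idt_arr Zer_arr Add_arr Dom_in_Obj Cod_in_Obj
  Cmp_assoc' Cmp_Idt Add_Zer Cmp_Add Cmp_Zer_right Cmp_Zer_left

lemma Cmp_Cmp:
  assumes "x \<in> Hom C A B" "f \<in> Hom C B D" "g \<in> Hom C D E" "g \<cdot> f = h"
  shows "g \<cdot> (f \<cdot> x) = h \<cdot> x"
  using Cmp_assoc[OF assms(1-3)] assms(4) by simp

text \<open>
  An equation \<open>g \<cdot> f = h\<close> does not match the right-bracketed \<open>g \<cdot> (f \<cdot> x)\<close>; this variant does.
\<close>

lemma Cmp_eq_assoc:
  "\<lbrakk>g \<cdot> f = h; f \<in> Arr C; g \<in> Arr C; Dom C g = Cod C f; x \<in> Arr C; Cod C x = Dom C f\<rbrakk>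
    \<Longrightarrow> g \<cdot> (f \<cdot> x) = h \<cdot> x"
  using Cmp_assoc'[of x f g] by simp

lemma Hom_Dom: "f \<in> Hom C A B \<Longrightarrow> Dom C f = A" and Hom_Cod: "f \<in> Hom C A B \<Longrightarrow> Cod C f = B"
  by (simp_all add: Hom_iff)

section \<open>Monomorphisms, kernels and short exact sequences\<close>

lemma is_kernel_arrows:
  assumes "is_kernel C k f"
  shows "k \<in> Hom C (Dom C k) (Dom C f)" "f \<in> Hom C (Dom C f) (Cod C f)"
    "f \<cdot> k = Zer C (Dom C k) (Cod C f)"
  using assms by (simp_all add: is_kernel_def Hom_def)

lemma is_cokernel_arrows:
  assumes "is_cokernel C c f"
  shows "c \<in> Hom C (Cod C f) (Cod C c)" "f \<in> Hom C (Dom C f) (Cod C f)"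
    "c \<cdot> f = Zer C (Dom C f) (Cod C c)"
  using assms by (simp_all add: is_cokernel_def Hom_def)

lemma monicD:
  assumes "monic C f" "f \<in> Hom C B D" "g \<in> Hom C A B" "h \<in> Hom C A B" "f \<cdot> g = f \<cdot> h"
  shows "g = h"
  using assms(1,3-5) unfolding monic_def Hom_Dom[OF assms(2)] by blast

lemma epicD:
  assumes "epic C f" "f \<in> Hom C A B" "g \<in> Hom C B D" "h \<in> Hom C B D" "g \<cdot> f = h \<cdot> f"
  shows "g = h"
  using assms(1,3-5) unfolding epic_def Hom_Cod[OF assms(2)] by blast

lemma monicI_zero:
  assumes f: "f \<in> Hom C B D"
    and z: "\<And>A g. g \<in> Hom C A B \<Longrightarrow> f \<cdot> g = Zer C A D \<Longrightarrow> g = Zer C A B"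
  shows "monic C f"
proof -
  have "g = h" if gh: "g \<in> Hom C A B" "h \<in> Hom C A B" and eq: "f \<cdot> g = f \<cdot> h" for A g h
  proof -
    obtain w where w: "w \<in> Hom C A B" "Add C h w = g" using exists_difference gh by blast
    have "Add C (f \<cdot> h) (f \<cdot> w) = f \<cdot> h" using Cmp_Add_right[OF gh(2) w(1) f] w(2) eq by simp
    then have "f \<cdot> w = Zer C A D" using Add_cancel_Zer[OF Cmp_in_Hom[OF gh(2) f] Cmp_in_Hom[OF w(1) f]] by blast
    then have w0: "w = Zer C A B" using z w(1) by blast
    show ?thesis using w(2) gh(2) unfolding w0 by (simp add: arrow_simps)
  qed
  then show ?thesis using f unfolding monic_def Hom_Dom[OF f] by (simp add: Hom_iff)
qed

lemma epicI_zero: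
  assumes f: "f \<in> Hom C A B"
    and z: "\<And>D g. g \<in> Hom C B D \<Longrightarrow> g \<cdot> f = Zer C A D \<Longrightarrow> g = Zer C B D"
  shows "epic C f"
proof -
  have "g = h" if gh: "g \<in> Hom C B D" "h \<in> Hom C B D" and eq: "g \<cdot> f = h \<cdot> f" for D g h
  proof -
    obtain w where w: "w \<in> Hom C B D" "Add C h w = g" using exists_difference gh by blast
    have "Add C (h \<cdot> f) (w \<cdot> f) = h \<cdot> f" using Cmp_Add_left[OF f gh(2) w(1)] w(2) eq by simp
    then have "w \<cdot> f = Zer C A D" using Add_cancel_Zer[OF Cmp_in_Hom[OF f gh(2)] Cmp_in_Hom[OF f w(1)]] by blast
    then have w0: "w = Zer C B D" using z w(1) by blast
    show ?thesis using w(2) gh(2) unfolding w0 by (simp add: arrow_simps)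
  qed
  then show ?thesis using f unfolding epic_def Hom_Cod[OF f] by (simp add: Hom_iff)
qed

lemma monic_zero:
  assumes "monic C f" "f \<in> Hom C B D" "g \<in> Hom C A B" "f \<cdot> g = Zer C A D"
  shows "g = Zer C A B"
proof -
  have z: "Zer C A B \<in> Hom C A B" using assms(3) Hom_Obj Zer_in_Hom by blast
  have "f \<cdot> Zer C A B = Zer C A D" using assms(2,3) by (simp add: arrow_simps)
  then show ?thesis using monicD[OF assms(1-3) z] assms(4) by simp
qed

lemma epic_zero:
  assumes "epic C f" "f \<in> Hom C A B" "g \<in> Hom C B D" "g \<cdot> f = Zer C A D"
  shows "g = Zer C B D"
proof -
  have z: "Zer C B D \<in> Hom C B D" using assms(3) Hom_Obj Zer_in_Hom by blast
  have "Zer C B D \<cdot> f = Zer C A D" using assms(2,3) by (simp add: arrow_simps)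
  then show ?thesis using epicD[OF assms(1-3) z] assms(4) by simp
qed

lemma epic_Cmp:
  assumes "f \<in> Hom C A B" "g \<in> Hom C B D" "epic C f" "epic C g"
  shows "epic C (g \<cdot> f)"
proof (rule epicI_zero)
  show "g \<cdot> f \<in> Hom C A D" using Cmp_in_Hom assms by blast
  fix E h assume h: "h \<in> Hom C D E" "h \<cdot> (g \<cdot> f) = Zer C A E"
  have "(h \<cdot> g) \<cdot> f = Zer C A E" using h Cmp_assoc[OF assms(1,2) h(1)] by simp
  then have "h \<cdot> g = Zer C B E" using epic_zero[OF assms(3,1) Cmp_in_Hom[OF assms(2) h(1)]] by blast
  then show "h = Zer C D E" using epic_zero[OF assms(4,2) h(1)] by blast
qed

lemma monic_Cmp:
  assumes "f \<in> Hom C A B" "g \<in> Hom C B D" "monic C f" "monic C g"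
  shows "monic C (g \<cdot> f)"
proof (rule monicI_zero)
  show "g \<cdot> f \<in> Hom C A D" using Cmp_in_Hom assms by blast
  fix E h assume h: "h \<in> Hom C E A" "(g \<cdot> f) \<cdot> h = Zer C E D"
  have "g \<cdot> (f \<cdot> h) = Zer C E D" using h Cmp_assoc[OF h(1) assms(1,2)] by simp
  then have "f \<cdot> h = Zer C E B" using monic_zero[OF assms(4,2) Cmp_in_Hom[OF h(1) assms(1)]] by blast
  then show "h = Zer C E A" using monic_zero[OF assms(3,1) h(1)] by blast
qed

lemma epic_cancel:
  assumes "f \<in> Hom C A B" "g \<in> Hom C B D" "epic C (g \<cdot> f)"
  shows "epic C g"
proof (rule epicI_zero[OF assms(2)])
  fix E h assume h: "h \<in> Hom C D E" "h \<cdot> g = Zer C B E"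
  have "h \<cdot> (g \<cdot> f) = Zer C A E"
    using Cmp_Cmp[OF assms(1,2) h] h(1) assms(1) by (simp add: arrow_simps)
  then show "h = Zer C D E" using epic_zero[OF assms(3) Cmp_in_Hom[OF assms(1,2)] h(1)] by blast
qed

lemma monic_cancel:
  assumes "f \<in> Hom C A B" "g \<in> Hom C B D" "monic C (g \<cdot> f)"
  shows "monic C f"
proof (rule monicI_zero[OF assms(1)])
  fix E h assume h: "h \<in> Hom C E A" "f \<cdot> h = Zer C E B"
  have "(g \<cdot> f) \<cdot> h = Zer C E D" using h assms by (simp add: arrow_simps)
  then show "h = Zer C E A" using monic_zero[OF assms(3) Cmp_in_Hom[OF assms(1,2)] h(1)] by blast
qed

lemma is_kernelD:
  assumes "is_kernel C k f" "f \<in> Hom C A B"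
  shows "k \<in> Hom C (Dom C k) A" "f \<cdot> k = Zer C (Dom C k) B" "monic C k"
    "\<And>E g. g \<in> Hom C E A \<Longrightarrow> f \<cdot> g = Zer C E B \<Longrightarrow> \<exists>h \<in> Hom C E (Dom C k). k \<cdot> h = g"
proof -
  show k: "k \<in> Hom C (Dom C k) A" and fk: "f \<cdot> k = Zer C (Dom C k) B"
    using is_kernel_arrows[OF assms(1)] Hom_Dom[OF assms(2)] Hom_Cod[OF assms(2)] by simp_all
  show "\<exists>h \<in> Hom C E (Dom C k). k \<cdot> h = g" if "g \<in> Hom C E A" "f \<cdot> g = Zer C E B" for E g
  proof -
    have "Dom C f = A" "Cod C f = B" using assms(2) by (auto simp: Hom_iff)
    then show ?thesis using assms(1) that Hom_Obj(1)[OF that(1)] unfolding is_kernel_def by blast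
  qed
  show "monic C k"
  proof (rule monicI_zero[OF k])
    fix E g assume g: "g \<in> Hom C E (Dom C k)" "k \<cdot> g = Zer C E A"
    have E: "E \<in> Obj C" using g Hom_Obj by blast
    have ex: "\<exists>!h. h \<in> Hom C E (Dom C k) \<and> k \<cdot> h = Zer C E A"
    proof -
      have "f \<cdot> Zer C E A = Zer C E (Cod C f)" "Zer C E A \<in> Hom C E (Dom C f)"
        using E assms(2) by (simp_all add: arrow_simps)
      then show ?thesis using assms E unfolding is_kernel_def by blast
    qed
    have "k \<cdot> Zer C E (Dom C k) = Zer C E A" "Zer C E (Dom C k) \<in> Hom C E (Dom C k)"
      using E k by (simp_all add: arrow_simps)
    then show "g = Zer C E (Dom C k)" using ex g by blast
  qed
qed

lemma is_kernelI:
  assumes "k \<in> Hom C K A" "f \<in> Hom C A B" "f \<cdot> k = Zer C K B" "monic C k"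
    "\<And>E g. g \<in> Hom C E A \<Longrightarrow> f \<cdot> g = Zer C E B \<Longrightarrow> \<exists>h \<in> Hom C E K. k \<cdot> h = g"
  shows "is_kernel C k f"
proof -
  have "\<exists>!h. h \<in> Hom C E K \<and> k \<cdot> h = g" if "g \<in> Hom C E A" "f \<cdot> g = Zer C E B" for E g
    using assms(5)[OF that] monicD[OF assms(4,1)] by blast
  moreover have "k \<in> Arr C" "f \<in> Arr C" "Dom C k = K" "Cod C k = A" "Dom C f = A" "Cod C f = B"
    using assms(1,2) by (auto simp: Hom_iff)
  ultimately show ?thesis using assms(3) unfolding is_kernel_def by simp
qed

lemma is_cokernelD:
  assumes "is_cokernel C c f" "f \<in> Hom C A B"
  shows "c \<in> Hom C B (Cod C c)" "c \<cdot> f = Zer C A (Cod C c)" "epic C c"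
    "\<And>E g. g \<in> Hom C B E \<Longrightarrow> g \<cdot> f = Zer C A E \<Longrightarrow> \<exists>h \<in> Hom C (Cod C c) E. h \<cdot> c = g"
proof -
  show c: "c \<in> Hom C B (Cod C c)" and cf: "c \<cdot> f = Zer C A (Cod C c)"
    using is_cokernel_arrows[OF assms(1)] Hom_Dom[OF assms(2)] Hom_Cod[OF assms(2)] by simp_all
  show "\<exists>h \<in> Hom C (Cod C c) E. h \<cdot> c = g" if "g \<in> Hom C B E" "g \<cdot> f = Zer C A E" for E g
  proof -
    have "Dom C f = A" "Cod C f = B" using assms(2) by (auto simp: Hom_iff)
    then show ?thesis using assms(1) that Hom_Obj(2)[OF that(1)] unfolding is_cokernel_def by blast
  qed
  show "epic C c"
  proof (rule epicI_zero[OF c])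
    fix E g assume g: "g \<in> Hom C (Cod C c) E" "g \<cdot> c = Zer C B E"
    have E: "E \<in> Obj C" using g Hom_Obj by blast
    have ex: "\<exists>!h. h \<in> Hom C (Cod C c) E \<and> h \<cdot> c = Zer C B E"
    proof -
      have "Zer C B E \<cdot> f = Zer C (Dom C f) E" "Zer C B E \<in> Hom C (Cod C f) E"
        using E assms(2) by (simp_all add: arrow_simps)
      then show ?thesis using assms E unfolding is_cokernel_def by blast
    qed
    have "Zer C (Cod C c) E \<cdot> c = Zer C B E" "Zer C (Cod C c) E \<in> Hom C (Cod C c) E"
      using E c by (simp_all add: arrow_simps)
    then show "g = Zer C (Cod C c) E" using ex g by blast
  qed
qed

lemma is_cokernelI:
  assumes "c \<in> Hom C B D" "f \<in> Hom C A B" "c \<cdot> f = Zer C A D" "epic C c"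
    "\<And>E g. g \<in> Hom C B E \<Longrightarrow> g \<cdot> f = Zer C A E \<Longrightarrow> \<exists>h \<in> Hom C D E. h \<cdot> c = g"
  shows "is_cokernel C c f"
proof -
  have "\<exists>!h. h \<in> Hom C D E \<and> h \<cdot> c = g" if "g \<in> Hom C B E" "g \<cdot> f = Zer C A E" for E g
    using assms(5)[OF that] epicD[OF assms(4,1)] by blast
  moreover have "c \<in> Arr C" "f \<in> Arr C" "Dom C c = B" "Cod C c = D" "Dom C f = A" "Cod C f = B"
    using assms(1,2) by (auto simp: Hom_iff)
  ultimately show ?thesis using assms(3) unfolding is_cokernel_def by simp
qed

lemma is_kernel_Cmp_monic:
  assumes m: "m \<in> Hom C B D" "monic C m" and e: "e \<in> Hom C A B"
  shows "is_kernel C k (m \<cdot> e) \<longleftrightarrow> is_kernel C k e"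
proof
  have me: "m \<cdot> e \<in> Hom C A D" using m e Cmp_in_Hom by blast
  { assume k: "is_kernel C k (m \<cdot> e)"
    note K = is_kernelD[OF k me]
    show "is_kernel C k e"
    proof (rule is_kernelI[OF K(1) e _ K(3)])
      have "m \<cdot> (e \<cdot> k) = Zer C (Dom C k) D" using K(2) Cmp_assoc[OF K(1) e m(1)] by simp
      then show "e \<cdot> k = Zer C (Dom C k) B"
        using monic_zero[OF m(2,1) Cmp_in_Hom[OF K(1) e]] by blast
      fix E g assume g: "g \<in> Hom C E A" "e \<cdot> g = Zer C E B"
      have "(m \<cdot> e) \<cdot> g = Zer C E D" using m e g by (simp add: arrow_simps)
      then show "\<exists>h \<in> Hom C E (Dom C k). k \<cdot> h = g" using K(4) g by blast
    qed }
  { assume k: "is_kernel C k e"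
    note K = is_kernelD[OF k e]
    show "is_kernel C k (m \<cdot> e)"
    proof (rule is_kernelI[OF K(1) me _ K(3)])
      show "(m \<cdot> e) \<cdot> k = Zer C (Dom C k) D" using m e K by (simp add: arrow_simps)
      fix E g assume g: "g \<in> Hom C E A" "(m \<cdot> e) \<cdot> g = Zer C E D"
      then have "m \<cdot> (e \<cdot> g) = Zer C E D" using Cmp_assoc[OF g(1) e m(1)] g(2) by simp
      then have "e \<cdot> g = Zer C E B" using monic_zero[OF m(2,1) Cmp_in_Hom[OF g(1) e]] by blast
      then show "\<exists>h \<in> Hom C E (Dom C k). k \<cdot> h = g" using K(4) g by blast
    qed }
qed

end

context abelian_category
begin

lemma kernel_of_cokernel:
  assumes m: "monic C m" "m \<in> Hom C A B" and c: "is_cokernel C c m"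
  shows "is_kernel C m c"
proof -
  obtain x where x: "is_kernel C m x" using monic_is_kernel m by blast
  note Cd = is_cokernelD[OF c m(2)]
  have xH: "x \<in> Hom C B (Cod C x)" using is_kernel_arrows(1,2)[OF x] m(2) by (simp add: Hom_iff)
  note K = is_kernelD[OF x xH]
  have D: "Dom C m = A" using m by (simp add: Hom_iff)
  show ?thesis
  proof (rule is_kernelI[OF m(2) Cd(1) Cd(2) m(1)])
    fix E g assume g: "g \<in> Hom C E B" "c \<cdot> g = Zer C E (Cod C c)"
    obtain y where y: "y \<in> Hom C (Cod C c) (Cod C x)" "y \<cdot> c = x"
      using Cd(4)[OF xH K(2)[unfolded D]] by blast
    have "x \<cdot> g = Zer C E (Cod C x)"
      using g y(1) Cd(1) Cmp_assoc[OF g(1) Cd(1) y(1)] unfolding y(2) by (simp add: arrow_simps)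
    then show "\<exists>h \<in> Hom C E A. m \<cdot> h = g" using K(4)[OF g(1)] unfolding D by blast
  qed
qed

lemma cokernel_of_kernel:
  assumes p: "epic C p" "p \<in> Hom C A B" and k: "is_kernel C k p"
  shows "is_cokernel C p k"
proof -
  obtain x where x: "is_cokernel C p x" using epic_is_cokernel p by blast
  note K = is_kernelD[OF k p(2)]
  have xH: "x \<in> Hom C (Dom C x) A" using is_cokernel_arrows(1,2)[OF x] p(2) by (simp add: Hom_iff)
  note Cd = is_cokernelD[OF x xH]
  have D: "Cod C p = B" using p by (simp add: Hom_iff)
  show ?thesis
  proof (rule is_cokernelI[OF p(2) K(1) K(2) p(1)])
    fix E g assume g: "g \<in> Hom C A E" "g \<cdot> k = Zer C (Dom C k) E"
    obtain y where y: "y \<in> Hom C (Dom C x) (Dom C k)" "k \<cdot> y = x"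
      using K(4)[OF xH Cd(2)[unfolded D]] by blast
    have "g \<cdot> x = Zer C (Dom C x) E"
      using g y(1) K(1) Cmp_assoc[OF y(1) K(1) g(1)] unfolding y(2) by (simp add: arrow_simps)
    then show "\<exists>h \<in> Hom C B E. h \<cdot> p = g" using Cd(4)[OF g(1)] unfolding D by blast
  qed
qed

text \<open>
  Two kernels of \<open>c\<close> factor through each other, so an arrow with one of them as kernel has the
  other one too.
\<close>

lemma is_kernel_transfer:
  assumes "is_kernel C m c" "is_kernel C i c" "is_kernel C m p"
  shows "is_kernel C i p"
proof -
  define A where "A = Cod C m"
  have c: "c \<in> Hom C A (Cod C c)" and p: "p \<in> Hom C A (Cod C p)"
    using is_kernel_arrows(1,2)[OF assms(1)] is_kernel_arrows(1,2)[OF assms(3)]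
    by (simp_all add: Hom_iff A_def)
  note M = is_kernelD[OF assms(1) c] and I = is_kernelD[OF assms(2) c]
    and P = is_kernelD[OF assms(3) p]
  obtain u where u: "u \<in> Hom C (Dom C i) (Dom C m)" "m \<cdot> u = i" using M(4)[OF I(1,2)] by blast
  obtain v where v: "v \<in> Hom C (Dom C m) (Dom C i)" "i \<cdot> v = m" using I(4)[OF M(1,2)] by blast
  show ?thesis
  proof (rule is_kernelI[OF I(1) p _ I(3)])
    show "p \<cdot> i = Zer C (Dom C i) (Cod C p)"
      using Cmp_Cmp[OF u(1) P(1) p P(2)] u P(1) p by (simp add: arrow_simps)
    fix E g assume g: "g \<in> Hom C E A" "p \<cdot> g = Zer C E (Cod C p)"
    obtain h where h: "h \<in> Hom C E (Dom C m)" "m \<cdot> h = g" using P(4)[OF g] by blast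
    have "i \<cdot> (v \<cdot> h) = g" using Cmp_Cmp[OF h(1) v(1) I(1) v(2)] h by simp
    then show "\<exists>h \<in> Hom C E (Dom C i). i \<cdot> h = g" using Cmp_in_Hom h v by blast
  qed
qed

text \<open>
  In the definition exactness at \<open>F\<close> goes through the image of \<open>i\<close>. Since a monomorphism in an
  abelian category is the kernel of its cokernel, it is its own image.
\<close>

lemma short_exact_iff:
  "short_exact C K i F p M \<longleftrightarrow> i \<in> Hom C K F \<and> p \<in> Hom C F M \<and> is_kernel C i p \<and> epic C p"
proof
  assume s: "short_exact C K i F p M"
  then obtain m c where mc: "is_cokernel C c i" "is_kernel C m c" "is_kernel C m p"
    by (auto simp: short_exact_def exact_at_def is_image_def)
  have i: "monic C i" "i \<in> Hom C K F" using s by (simp_all add: short_exact_def)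
  have "is_kernel C i c" using kernel_of_cokernel[OF i mc(1)] .
  then have "is_kernel C i p" using is_kernel_transfer[OF mc(2) _ mc(3)] by blast
  then show "i \<in> Hom C K F \<and> p \<in> Hom C F M \<and> is_kernel C i p \<and> epic C p"
    using s by (simp add: short_exact_def)
next
  assume s: "i \<in> Hom C K F \<and> p \<in> Hom C F M \<and> is_kernel C i p \<and> epic C p"
  then have "is_cokernel C p i" using cokernel_of_kernel by blast
  moreover have "monic C i" using is_kernelD s by blast
  ultimately show "short_exact C K i F p M"
    using s by (auto simp: short_exact_def exact_at_def is_image_def Hom_iff)
qed

lemma short_exactD:
  assumes "short_exact C K i F p M"
  shows "i \<in> Hom C K F" "p \<in> Hom C F M" "p \<cdot> i = Zer C K M" "monic C i" "epic C p"
    "\<And>E g. g \<in> Hom C E F \<Longrightarrow> p \<cdot> g = Zer C E M \<Longrightarrow> \<exists>h \<in> Hom C E K. i \<cdot> h = g"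
    "\<And>E g. g \<in> Hom C F E \<Longrightarrow> g \<cdot> i = Zer C K E \<Longrightarrow> \<exists>h \<in> Hom C M E. h \<cdot> p = g"
proof -
  have s: "i \<in> Hom C K F" "p \<in> Hom C F M" "is_kernel C i p" "epic C p"
    using assms short_exact_iff by auto
  have D: "Dom C i = K" "Cod C p = M" using s by (auto simp: Hom_iff)
  note K = is_kernelD[OF s(3,2), unfolded D]
  note Q = is_cokernelD[OF cokernel_of_kernel[OF s(4,2,3)] s(1), unfolded D]
  show "i \<in> Hom C K F" "p \<in> Hom C F M" "p \<cdot> i = Zer C K M" "monic C i" "epic C p"
    using s K(2,3) by blast+
  show "\<exists>h \<in> Hom C E K. i \<cdot> h = g" if "g \<in> Hom C E F" "p \<cdot> g = Zer C E M" for E g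
    using K(4) that .
  show "\<exists>h \<in> Hom C M E. h \<cdot> p = g" if "g \<in> Hom C F E" "g \<cdot> i = Zer C K E" for E g
    using Q(4) that .
qed

lemma short_exactI:
  assumes "i \<in> Hom C K F" "p \<in> Hom C F M" "p \<cdot> i = Zer C K M" "monic C i" "epic C p"
    "\<And>E g. g \<in> Hom C E F \<Longrightarrow> p \<cdot> g = Zer C E M \<Longrightarrow> \<exists>h \<in> Hom C E K. i \<cdot> h = g"
  shows "short_exact C K i F p M"
  using is_kernelI[OF assms(1,2,3,4,6)] assms short_exact_iff by blast

lemma epic_short_exact:
  assumes "epic C p" "p \<in> Hom C F M" shows "\<exists>K i. short_exact C K i F p M"
proof -
  obtain i where i: "is_kernel C i p" using has_kernel assms by (auto simp: Hom_iff)
  then show ?thesis using short_exact_iff is_kernelD(1)[OF i assms(2)] assms by blast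
qed

text \<open>
  Exactness at the middle object means that \<open>f\<close> maps onto the kernel \<open>m\<close> of \<open>g\<close>: the kernel \<open>m\<close> is
  the image of \<open>f\<close>, and \<open>f\<close> is an epimorphism onto its image.
\<close>

lemma exact_at_epic_part:
  assumes ex: "exact_at C f g" and f: "f \<in> Hom C A B" and m: "is_kernel C m g" "m \<in> Hom C Z B"
  shows "\<exists>e \<in> Hom C A Z. epic C e \<and> m \<cdot> e = f"
proof -
  obtain m' c where c: "is_cokernel C c f" "is_kernel C m' c" "is_kernel C m' g"
    using ex by (auto simp: exact_at_def is_image_def)
  have mc: "is_kernel C m c" using is_kernel_transfer[OF c(3) m(1) c(2)] .
  note Cd = is_cokernelD[OF c(1) f]
  note K = is_kernelD[OF mc Cd(1)]
  have DZ: "Dom C m = Z" using m by (simp add: Hom_iff)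
  obtain e where e: "e \<in> Hom C A Z" "m \<cdot> e = f" using K(4)[OF f Cd(2)] DZ by blast
  have "epic C e"
  proof (rule epicI_zero[OF e(1)])
    fix D w assume w: "w \<in> Hom C Z D" "w \<cdot> e = Zer C A D"
    obtain k where k: "is_kernel C k w" using has_kernel w by (auto simp: Hom_iff)
    note Kk = is_kernelD[OF k w(1)]
    obtain e' where e': "e' \<in> Hom C A (Dom C k)" "k \<cdot> e' = e" using Kk(4)[OF e(1) w(2)] by blast
    \<comment> \<open>\<open>f\<close> factors through \<open>ker w\<close>. As \<open>m \<cdot> k\<close> is itself a kernel, minimality of the image gives
        \<open>k\<close> a right inverse.\<close>
    have mk: "monic C (m \<cdot> k)" "m \<cdot> k \<in> Hom C (Dom C k) B"
      using monic_Cmp[OF Kk(1) m(2) Kk(3) K(3)] Cmp_in_Hom[OF Kk(1) m(2)] by auto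
    obtain x where x: "is_kernel C (m \<cdot> k) x" using monic_is_kernel mk by blast
    have xH: "x \<in> Hom C B (Cod C x)" using is_kernel_arrows(1,2)[OF x] mk(2) by (simp add: Hom_iff)
    note Kx = is_kernelD[OF x xH]
    have Dmk: "Dom C (m \<cdot> k) = Dom C k" using mk by (simp add: Hom_iff)
    have "(m \<cdot> k) \<cdot> e' = f" using e e' Cmp_assoc[OF e'(1) Kk(1) m(2)] by simp
    then have "x \<cdot> f = Zer C A (Cod C x)"
      using Cmp_Cmp[OF e'(1) mk(2) xH Kx(2)[unfolded Dmk]] e' xH by (simp add: arrow_simps)
    then obtain y where y: "y \<in> Hom C (Cod C c) (Cod C x)" "y \<cdot> c = x" using Cd(4)[OF xH] by blast
    have "x \<cdot> m = y \<cdot> (c \<cdot> m)" using y Cmp_assoc[OF m(2) Cd(1) y(1)] by simp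
    also have "\<dots> = Zer C Z (Cod C x)" using y(1) m K(2) DZ by (simp add: arrow_simps)
    finally obtain t where t: "t \<in> Hom C Z (Dom C k)" "(m \<cdot> k) \<cdot> t = m"
      using Kx(4)[OF m(2)] Dmk by auto
    have Z: "Z \<in> Obj C" using w Hom_Obj by blast
    have "m \<cdot> (k \<cdot> t) = m \<cdot> Idt C Z"
      using t m(2) Cmp_assoc[OF t(1) Kk(1) m(2)] Cmp_Idt_right by simp
    then have kt: "k \<cdot> t = Idt C Z"
      using monicD[OF K(3) m(2)] Cmp_in_Hom[OF t(1) Kk(1)] Idt_in_Hom[OF Z] by blast
    have "w = w \<cdot> (k \<cdot> t)" using kt Cmp_Idt_right w by simp
    also have "\<dots> = Zer C Z D" using Cmp_Cmp[OF t(1) Kk(1) w(1) Kk(2)] t(1) w(1) by (simp add: arrow_simps)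
    finally show "w = Zer C Z D" .
  qed
  then show ?thesis using e by blast
qed

lemma exact_at_Cmp_monic:
  assumes "exact_at C f (m \<cdot> e)" "m \<in> Hom C B D" "monic C m" "e \<in> Hom C A B"
  shows "exact_at C f e"
  using assms is_kernel_Cmp_monic[OF assms(2-4)] Cmp_arr[of e m] by (auto simp: exact_at_def Hom_iff)

text \<open>
  This splices short exact sequences: an epimorphism onto \<open>K\<close> does not change the cokernel of \<open>k\<close>,
  and a monomorphism out of \<open>M\<close> does not change the kernel of \<open>p\<close>.
\<close>

lemma exact_at_Cmp:
  assumes s: "short_exact C K k B p M" and e: "e \<in> Hom C A K" "epic C e"
    and m: "m \<in> Hom C M D" "monic C m"
  shows "exact_at C (k \<cdot> e) (m \<cdot> p)"
proof -
  note S = short_exactD[OF s]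
  have ke: "k \<cdot> e \<in> Hom C A B" using Cmp_in_Hom e S by blast
  have kp: "is_kernel C k p" using s short_exact_iff by blast
  have "is_cokernel C p (k \<cdot> e)"
  proof (rule is_cokernelI[OF S(2) ke _ S(5)])
    show "p \<cdot> (k \<cdot> e) = Zer C A M"
      using Cmp_Cmp[OF e(1) S(1,2,3)] e S(2) by (simp add: arrow_simps)
    fix E g assume g: "g \<in> Hom C B E" "g \<cdot> (k \<cdot> e) = Zer C A E"
    have "(g \<cdot> k) \<cdot> e = Zer C A E" using g(2) Cmp_assoc[OF e(1) S(1) g(1)] by simp
    then have "g \<cdot> k = Zer C K E" using epic_zero[OF e(2,1) Cmp_in_Hom[OF S(1) g(1)]] by blast
    then show "\<exists>h \<in> Hom C M E. h \<cdot> p = g" using S(7) g by blast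
  qed
  moreover have "is_kernel C k (m \<cdot> p)" using kp is_kernel_Cmp_monic m S by blast
  ultimately show ?thesis using kp ke Cmp_in_Hom[OF S(2) m(1)]
    by (auto simp: exact_at_def is_image_def Hom_iff)
qed

lemma monic_epic_iso:
  assumes "f \<in> Hom C A B" "monic C f" "epic C f"
  shows "\<exists>g \<in> Hom C B A. g \<cdot> f = Idt C A \<and> f \<cdot> g = Idt C B"
proof -
  obtain x where x: "is_kernel C f x" using monic_is_kernel assms by blast
  have xH: "x \<in> Hom C B (Cod C x)" using is_kernel_arrows(1,2)[OF x] assms(1) by (simp add: Hom_iff)
  note K = is_kernelD[OF x xH]
  have D: "Dom C f = A" using assms by (simp add: Hom_iff)
  have B: "A \<in> Obj C" "B \<in> Obj C" using assms Hom_Obj by auto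
  have "x = Zer C B (Cod C x)" using epic_zero[OF assms(3,1) xH] K(2) D by simp
  then have "x \<cdot> Idt C B = Zer C B (Cod C x)" using Cmp_Idt_right[OF xH] by simp
  then obtain g where g: "g \<in> Hom C B A" "f \<cdot> g = Idt C B"
    using K(4)[OF Idt_in_Hom[OF B(2)]] D by auto
  have "f \<cdot> (g \<cdot> f) = f \<cdot> Idt C A"
    using Cmp_Cmp[OF assms(1) g(1) assms(1) g(2)] assms(1) Cmp_Idt_left Cmp_Idt_right by simp
  then have "g \<cdot> f = Idt C A"
    using monicD[OF assms(2,1)] Cmp_in_Hom[OF assms(1) g(1)] Idt_in_Hom[OF B(1)] by blast
  then show ?thesis using g by blast
qed

end

section \<open>Vanishing of Ext by extension of arrows\<close>

definition extendable :: "('o, 'm) preadd_cat \<Rightarrow> 'm \<Rightarrow> 'o \<Rightarrow> bool" where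
  "extendable C k M \<longleftrightarrow>
     (\<forall>f \<in> Hom C (Dom C k) M. \<exists>g \<in> Hom C (Cod C k) M. g \<cdot>\<^bsub>C\<^esub> k = f)"

text \<open>
  This says \<open>Ext\<^sup>n\<^sup>+\<^sup>1(G, M) = 0\<close>; the shift of the index avoids degree \<open>0\<close>, which is not about
  extensions. In degree one all short exact sequences ending in \<open>G\<close> are admitted, not just those
  with a projective middle term: in this form the property can be applied to the sequences that
  arise by pulling back.
\<close>

primrec ext_vanishes :: "('o, 'm) preadd_cat \<Rightarrow> nat \<Rightarrow> 'o \<Rightarrow> 'o \<Rightarrow> bool" where
  "ext_vanishes C 0 G M \<longleftrightarrow> (\<forall>K k B p. short_exact C K k B p G \<longrightarrow> extendable C k M)"
| "ext_vanishes C (Suc n) G M \<longleftrightarrow>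
     (\<forall>K k P p. short_exact C K k P p G \<and> projective C P \<longrightarrow> ext_vanishes C n K M)"

text \<open>
  \<open>G'\<close> is a retract of \<open>G\<close> in the stable category, where arrows that factor through a projective
  object are set to zero. Syzygies of one object are isomorphic in the stable category only, and a
  one-sided inverse is enough to transport vanishing.
\<close>

definition retract_modulo_projectives :: "('o, 'm) preadd_cat \<Rightarrow> 'o \<Rightarrow> 'o \<Rightarrow> bool" where
  "retract_modulo_projectives C G' G \<longleftrightarrow>
     (\<exists>a \<in> Hom C G' G. \<exists>b \<in> Hom C G G'. \<exists>T. projective C T \<and>
        (\<exists>s \<in> Hom C G' T. \<exists>t \<in> Hom C T G'.
           Add C (b \<cdot>\<^bsub>C\<^esub> a) (t \<cdot>\<^bsub>C\<^esub> s) = Idt C G'))"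

locale abelian_category_enough_projectives = abelian_category +
  assumes enough_projectives: "enough_projectives C"

lemma trivial_FactGroup_iff:
  assumes "N \<lhd> G" shows "trivial_group (G Mod N) \<longleftrightarrow> carrier G \<subseteq> N"
proof -
  interpret normal N G using assms .
  have t: "trivial_group (G Mod N) \<longleftrightarrow> (\<lambda>x. N #>\<^bsub>G\<^esub> x) ` carrier G = {N}"
    using factorgroup_is_group by (simp add: trivial_group_def carrier_FactGroup)
  show ?thesis
  proof
    assume "trivial_group (G Mod N)"
    then have "N #>\<^bsub>G\<^esub> x = N" if "x \<in> carrier G" for x using t that by blast
    then show "carrier G \<subseteq> N" using coset_join1[OF _ _ subgroup_axioms] by (meson subsetI)
  next
    assume "carrier G \<subseteq> N"
    then have "N #>\<^bsub>G\<^esub> x = N" if "x \<in> carrier G" for x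
      using coset_join2[OF that subgroup_axioms] that by (meson subsetD)
    then have "(\<lambda>x. N #>\<^bsub>G\<^esub> x) ` carrier G = {N}"
      using one_closed by (metis image_constant_conv image_cong empty_iff)
    then show "trivial_group (G Mod N)" using t by simp
  qed
qed

context abelian_category_enough_projectives
begin

lemma projective_lift:
  assumes "projective C P" "epic C e" "e \<in> Hom C A B" "f \<in> Hom C P B"
  obtains g where "g \<in> Hom C P A" "e \<cdot> g = f"
  using assms Hom_Dom[OF assms(3)] Hom_Cod[OF assms(3)] unfolding projective_def by metis

lemma projective_cover:
  assumes "A \<in> Obj C"
  obtains K k P p where "projective C P" "short_exact C K k P p A"
  using assms enough_projectives epic_short_exact unfolding enough_projectives_def by metis

text \<open>
  With enough projectives, arrows out of projective objects serve as generalized elements: an arrow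
  is epic as soon as all of them lift along it.
\<close>

lemma epicI_projective_lift:
  assumes q: "q \<in> Hom C A B"
    and lift: "\<And>T z. projective C T \<Longrightarrow> z \<in> Hom C T B \<Longrightarrow> \<exists>x \<in> Hom C T A. q \<cdot> x = z"
  shows "epic C q"
proof -
  obtain T z where z: "projective C T" "z \<in> Hom C T B" "epic C z"
    using enough_projectives Hom_Obj(2)[OF q] unfolding enough_projectives_def by metis
  then obtain x where "x \<in> Hom C T A" "q \<cdot> x = z" using lift by blast
  then show ?thesis using epic_cancel q z(3) by metis
qed

text \<open>
  The kernel of a composite of two epimorphisms is an extension of the kernel of the second by the
  kernel of the first.
\<close>

lemma short_exact_Cmp:
  assumes E: "short_exact C N n E e B" and S: "short_exact C A i B p D"
  obtains A' k j q where "short_exact C A' k E (p \<cdot> e) D" "short_exact C N j A' q A"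
    "k \<cdot> j = n" "i \<cdot> q = e \<cdot> k"
proof -
  note E = short_exactD[OF E] and S = short_exactD[OF S]
  have pe: "p \<cdot> e \<in> Hom C E D" "epic C (p \<cdot> e)"
    using Cmp_in_Hom[OF E(2) S(2)] epic_Cmp[OF E(2) S(2) E(5) S(5)] .
  then obtain A' k where K': "short_exact C A' k E (p \<cdot> e) D" using epic_short_exact by blast
  note K = short_exactD[OF K']
  have ek: "e \<cdot> k \<in> Hom C A' B" using Cmp_in_Hom[OF K(1) E(2)] .
  have "p \<cdot> (e \<cdot> k) = Zer C A' D" using K(3) Cmp_assoc[OF K(1) E(2) S(2)] by simp
  then obtain q where q: "q \<in> Hom C A' A" "i \<cdot> q = e \<cdot> k" using S(6)[OF ek] by blast
  have "(p \<cdot> e) \<cdot> n = Zer C N D" using E(1-3) S(2) by (simp add: arrow_simps)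
  then obtain j where j: "j \<in> Hom C N A'" "k \<cdot> j = n" using K(6)[OF E(1)] by blast
  have "short_exact C N j A' q A"
  proof (rule short_exactI[OF j(1) q(1)])
    have "i \<cdot> (q \<cdot> j) = Zer C N B"
      using j q E(1-3) S(1) K(1) by (simp add: arrow_simps Cmp_eq_assoc[OF q(2)])
    then show "q \<cdot> j = Zer C N A" using monic_zero[OF S(4,1) Cmp_in_Hom[OF j(1) q(1)]] by blast
    show "monic C j" using monic_cancel[OF j(1) K(1)] j(2) E(4) by simp
    show "epic C q"
    proof (rule epicI_projective_lift[OF q(1)])
      fix T z assume z: "projective C T" "z \<in> Hom C T A"
      obtain y where y: "y \<in> Hom C T E" "e \<cdot> y = i \<cdot> z"
        using projective_lift[OF z(1) E(5,2) Cmp_in_Hom[OF z(2) S(1)]] .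
      have "(p \<cdot> e) \<cdot> y = Zer C T D"
        using y z E(2) S(1-3) by (simp add: arrow_simps Cmp_eq_assoc[OF S(3)])
      then obtain x where x: "x \<in> Hom C T A'" "k \<cdot> x = y" using K(6)[OF y(1)] by blast
      have "i \<cdot> (q \<cdot> x) = i \<cdot> z"
        using x y(2) q S(1) K(1) E(2) by (simp add: arrow_simps Cmp_eq_assoc[OF q(2)])
      then have "q \<cdot> x = z" using monicD[OF S(4,1) Cmp_in_Hom[OF x(1) q(1)] z(2)] by blast
      then show "\<exists>x \<in> Hom C T A'. q \<cdot> x = z" using x(1) by blast
    qed
    fix Z g assume g: "g \<in> Hom C Z A'" "q \<cdot> g = Zer C Z A"
    have "e \<cdot> (k \<cdot> g) = (i \<cdot> q) \<cdot> g" using g(1) q E(2) K(1) by (simp add: arrow_simps)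
    also have "\<dots> = Zer C Z B" using g q(1) S(1) by (simp add: arrow_simps)
    finally obtain h where h: "h \<in> Hom C Z N" "n \<cdot> h = k \<cdot> g"
      using E(6)[OF Cmp_in_Hom[OF g(1) K(1)]] by blast
    have "k \<cdot> (j \<cdot> h) = k \<cdot> g" using Cmp_Cmp[OF h(1) j(1) K(1) j(2)] h(2) by simp
    then have "j \<cdot> h = g" using monicD[OF K(4,1) Cmp_in_Hom[OF h(1) j(1)] g(1)] by blast
    then show "\<exists>h \<in> Hom C Z N. j \<cdot> h = g" using h(1) by blast
  qed
  then show thesis using that K' j q by blast
qed

text \<open>
  Let \<open>b \<cdot> a + t \<cdot> s = 1\<close> on \<open>G'\<close>. Lift \<open>a\<close>, \<open>b\<close> and \<open>t\<close> to the projective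
  objects as \<open>\<alpha>\<close>, \<open>\<beta>\<close>, \<open>\<tau>\<close>. Then \<open>\<beta> \<cdot> \<alpha> + \<tau> \<cdot> s \<cdot> p'\<close> lies over the
  identity of \<open>G'\<close>, so it differs from the identity of \<open>P'\<close> by an arrow \<open>k' \<cdot> h\<close>. On the syzygy the
  term with \<open>\<tau>\<close> is killed by \<open>p' \<cdot> k' = 0\<close>, and what remains is \<open>1 = wb \<cdot> wa + h \<cdot> k'\<close>: a retraction up
  to an arrow through \<open>P'\<close>.
\<close>

lemma syzygy_comparison:
  assumes S: "short_exact C L k P p G" and S': "short_exact C L' k' P' p' G'"
    and P: "projective C P" "projective C P'" and r: "retract_modulo_projectives C G' G"
  obtains wa wb \<alpha> h where "wa \<in> Hom C L' L" "wb \<in> Hom C L L'" "\<alpha> \<in> Hom C P' P" "h \<in> Hom C P' L'"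
    "k \<cdot> wa = \<alpha> \<cdot> k'" "Add C (wb \<cdot> wa) (h \<cdot> k') = Idt C L'"
proof -
  obtain a b T s t where r: "a \<in> Hom C G' G" "b \<in> Hom C G G'" "projective C T" "s \<in> Hom C G' T"
    "t \<in> Hom C T G'" and abst: "Add C (b \<cdot> a) (t \<cdot> s) = Idt C G'"
    using r unfolding retract_modulo_projectives_def by blast
  note S = short_exactD[OF S] and S' = short_exactD[OF S']
  obtain \<alpha> where \<alpha>: "\<alpha> \<in> Hom C P' P" "p \<cdot> \<alpha> = a \<cdot> p'"
    using projective_lift[OF P(2) S(5,2) Cmp_in_Hom[OF S'(2) r(1)]] .
  obtain \<beta> where \<beta>: "\<beta> \<in> Hom C P P'" "p' \<cdot> \<beta> = b \<cdot> p"
    using projective_lift[OF P(1) S'(5,2) Cmp_in_Hom[OF S(2) r(2)]] .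
  obtain \<tau> where \<tau>: "\<tau> \<in> Hom C T P'" "p' \<cdot> \<tau> = t"
    using projective_lift[OF r(3) S'(5,2) r(5)] .
  have "p \<cdot> (\<alpha> \<cdot> k') = Zer C L' G"
    using \<alpha> S(2) S'(1-3) r(1) by (simp add: arrow_simps Cmp_eq_assoc[OF \<alpha>(2)])
  then obtain wa where wa: "wa \<in> Hom C L' L" "k \<cdot> wa = \<alpha> \<cdot> k'"
    using S(6)[OF Cmp_in_Hom[OF S'(1) \<alpha>(1)]] by blast
  have "p' \<cdot> (\<beta> \<cdot> k) = Zer C L G'"
    using \<beta> S'(2) S(1-3) r(2) by (simp add: arrow_simps Cmp_eq_assoc[OF \<beta>(2)])
  then obtain wb where wb: "wb \<in> Hom C L L'" "k' \<cdot> wb = \<beta> \<cdot> k"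
    using S'(6)[OF Cmp_in_Hom[OF S(1) \<beta>(1)]] by blast
  define u where "u = Add C (\<beta> \<cdot> \<alpha>) (\<tau> \<cdot> (s \<cdot> p'))"
  have u: "u \<in> Hom C P' P'" using \<alpha>(1) \<beta>(1) \<tau>(1) r S'(2) by (simp add: u_def arrow_simps)
  have P': "P' \<in> Obj C" "L' \<in> Obj C" using u S'(1) Hom_Obj by auto
  have "p' \<cdot> u = Add C (b \<cdot> (a \<cdot> p')) (t \<cdot> (s \<cdot> p'))"
    using \<alpha> \<beta> \<tau> r S'(2) S(2)
    by (simp add: u_def arrow_simps Cmp_eq_assoc[OF \<beta>(2)] Cmp_eq_assoc[OF \<tau>(2)])
  also have "\<dots> = Add C (b \<cdot> a) (t \<cdot> s) \<cdot> p'"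
    using r S'(2) by (simp add: arrow_simps)
  finally have pu: "p' \<cdot> u = p'" unfolding abst using Cmp_Idt_left S'(2) by simp
  obtain h0 where h0: "h0 \<in> Hom C P' P'" "Add C u h0 = Idt C P'"
    using exists_difference[OF Idt_in_Hom[OF P'(1)] u] by blast
  have "Add C p' (p' \<cdot> h0) = p'"
    using Cmp_Add_right[OF u h0(1) S'(2)] Cmp_Idt_right[OF S'(2)] unfolding pu h0(2) by simp
  then have "p' \<cdot> h0 = Zer C P' G'"
    using Add_cancel_Zer[OF S'(2) Cmp_in_Hom[OF h0(1) S'(2)]] by blast
  then obtain h where h: "h \<in> Hom C P' L'" "k' \<cdot> h = h0" using S'(6)[OF h0(1)] by blast
  have uk: "u \<cdot> k' = k' \<cdot> (wb \<cdot> wa)"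
  proof -
    have "u \<cdot> k' = \<beta> \<cdot> (\<alpha> \<cdot> k')"
      using \<alpha>(1) \<beta>(1) \<tau>(1) r S'(1-3) by (simp add: u_def arrow_simps)
    also have "\<dots> = (\<beta> \<cdot> k) \<cdot> wa"
      using \<beta>(1) wa S(1) by (simp add: arrow_simps)
    also have "\<dots> = k' \<cdot> (wb \<cdot> wa)"
      unfolding wb(2)[symmetric] using Cmp_assoc[OF wa(1) wb(1) S'(1)] .
    finally show ?thesis .
  qed
  have "k' \<cdot> Add C (wb \<cdot> wa) (h \<cdot> k') = Add C (u \<cdot> k') (h0 \<cdot> k')"
    unfolding uk h(2)[symmetric] using wa(1) wb(1) h(1) S'(1) by (simp add: arrow_simps)
  also have "\<dots> = k' \<cdot> Idt C L'"
    using Cmp_Add_left[OF S'(1) u h0(1)] S'(1) unfolding h0(2)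
    by (simp add: Cmp_Idt_left[OF S'(1)] Cmp_Idt_right[OF S'(1)])
  finally have "Add C (wb \<cdot> wa) (h \<cdot> k') = Idt C L'"
    using monicD[OF S'(4,1) _ Idt_in_Hom[OF P'(2)]]
      Add_in_Hom[OF Cmp_in_Hom[OF wa(1) wb(1)] Cmp_in_Hom[OF S'(1) h(1)]] by blast
  then show thesis using that wa wb(1) \<alpha>(1) h(1) by blast
qed

lemma retract_modulo_projectives_syzygy:
  assumes S: "short_exact C L k P p G" and S': "short_exact C L' k' P' p' G'"
    and P: "projective C P" "projective C P'" and r: "retract_modulo_projectives C G' G"
  shows "retract_modulo_projectives C L' L"
proof -
  obtain wa wb \<alpha> h where "wa \<in> Hom C L' L" "wb \<in> Hom C L L'" "h \<in> Hom C P' L'"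
    "Add C (wb \<cdot> wa) (h \<cdot> k') = Idt C L'"
    using syzygy_comparison[OF S S' P r] .
  then show ?thesis
    using P(2) short_exactD(1)[OF S'] unfolding retract_modulo_projectives_def by blast
qed

lemma extendableD:
  assumes "extendable C k M" "k \<in> Hom C K B" "f \<in> Hom C K M"
  obtains g where "g \<in> Hom C B M" "g \<cdot> k = f"
  using assms(1,3) unfolding extendable_def Hom_Dom[OF assms(2)] Hom_Cod[OF assms(2)] by blast

lemma extendableI:
  assumes "k \<in> Hom C K B" "\<And>f. f \<in> Hom C K M \<Longrightarrow> \<exists>g \<in> Hom C B M. g \<cdot> k = f"
  shows "extendable C k M"
  using assms(2) unfolding extendable_def Hom_Dom[OF assms(1)] Hom_Cod[OF assms(1)] by blast

lemma extendable_syzygy_transfer: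
  assumes S: "short_exact C L k P p G" and S': "short_exact C L' k' P' p' G'"
    and P: "projective C P" "projective C P'" and r: "retract_modulo_projectives C G' G"
    and e: "extendable C k M"
  shows "extendable C k' M"
proof (rule extendableI[OF short_exactD(1)[OF S']])
  fix f assume f: "f \<in> Hom C L' M"
  note k = short_exactD(1)[OF S] and k' = short_exactD(1)[OF S']
  obtain wa wb \<alpha> h where w: "wa \<in> Hom C L' L" "wb \<in> Hom C L L'" "\<alpha> \<in> Hom C P' P" "h \<in> Hom C P' L'"
    "k \<cdot> wa = \<alpha> \<cdot> k'" "Add C (wb \<cdot> wa) (h \<cdot> k') = Idt C L'"
    using syzygy_comparison[OF S S' P r] .
  obtain g where g: "g \<in> Hom C P M" "g \<cdot> k = f \<cdot> wb"
    using extendableD[OF e k Cmp_in_Hom[OF w(2) f]] .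
  have "Add C (g \<cdot> \<alpha>) (f \<cdot> h) \<cdot> k' = Add C (g \<cdot> (k \<cdot> wa)) (f \<cdot> (h \<cdot> k'))"
    using g(1) f w(3,4,5) k' by (simp add: arrow_simps)
  also have "\<dots> = f \<cdot> Add C (wb \<cdot> wa) (h \<cdot> k')"
    using g f w(1-4) k k' by (simp add: arrow_simps Cmp_eq_assoc[OF g(2)])
  also have "\<dots> = f" unfolding w(6) using Cmp_Idt_right f by simp
  finally show "\<exists>g \<in> Hom C P' M. g \<cdot> k' = f"
    using Add_in_Hom[OF Cmp_in_Hom[OF w(3) g(1)] Cmp_in_Hom[OF w(4) f]] by blast
qed

text \<open>
  The correction term is the zero arrow, which factors through any projective object.
\<close>

lemma retract_modulo_projectives_if_retract:
  assumes "a \<in> Hom C G' G" "b \<in> Hom C G G'" "b \<cdot> a = Idt C G'"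
  shows "retract_modulo_projectives C G' G"
proof -
  have G': "G' \<in> Obj C" using assms Hom_Obj by blast
  obtain K k T p where T: "projective C T" "short_exact C K k T p G'"
    using projective_cover[OF G'] .
  then have TO: "T \<in> Obj C" by (simp add: projective_def)
  have "Add C (b \<cdot> a) (Zer C T G' \<cdot> Zer C G' T) = Idt C G'"
    using G' TO assms(3) by (simp add: arrow_simps)
  then show ?thesis
    using assms(1,2) T(1) Zer_in_Hom[OF G' TO] Zer_in_Hom[OF TO G']
    unfolding retract_modulo_projectives_def by blast
qed

lemma retract_modulo_projectives_refl:
  "G \<in> Obj C \<Longrightarrow> retract_modulo_projectives C G G"
  using retract_modulo_projectives_if_retract[OF Idt_in_Hom Idt_in_Hom] Cmp_Idt_left[OF Idt_in_Hom]
  by blast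

lemma short_exact_Obj: "short_exact C K k B p G \<Longrightarrow> K \<in> Obj C \<and> B \<in> Obj C \<and> G \<in> Obj C"
  using short_exactD(1,2) Hom_Obj by blast

text \<open>
  For a given sequence ending in \<open>G\<close>, with middle term \<open>B\<close>, choose a projective object \<open>P1\<close> that maps
  onto \<open>B\<close>. It maps onto \<open>G\<close> too, and there extension is known by comparing syzygies. The extension
  to \<open>P1\<close> kills the kernel of \<open>P1 \<rightarrow> B\<close>, hence descends to \<open>B\<close>.
\<close>

lemma ext_vanishes_0I:
  assumes S: "short_exact C K k P p G" and P: "projective C P" and e: "extendable C k M"
  shows "ext_vanishes C 0 G M"
  unfolding ext_vanishes.simps
proof (intro allI impI)
  fix K' k' B b assume S': "short_exact C K' k' B b G"
  note B = short_exactD[OF S']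
  have G: "G \<in> Obj C" "B \<in> Obj C" using short_exact_Obj S' by auto
  obtain N n P1 e1 where P1: "projective C P1" "short_exact C N n P1 e1 B"
    using projective_cover[OF G(2)] .
  obtain A' k1 j q where s: "short_exact C A' k1 P1 (b \<cdot> e1) G" "short_exact C N j A' q K'"
    "k1 \<cdot> j = n" "k' \<cdot> q = e1 \<cdot> k1"
    using short_exact_Cmp[OF P1(2) S'] .
  have e1: "extendable C k1 M"
    using extendable_syzygy_transfer[OF S s(1) P P1(1) retract_modulo_projectives_refl[OF G(1)] e] .
  note K1 = short_exactD[OF s(1)] and Q = short_exactD[OF s(2)] and N = short_exactD[OF P1(2)]
  show "extendable C k' M"
  proof (rule extendableI[OF B(1)])
    fix f assume f: "f \<in> Hom C K' M"
    obtain g where g: "g \<in> Hom C P1 M" "g \<cdot> k1 = f \<cdot> q"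
      using extendableD[OF e1 K1(1) Cmp_in_Hom[OF Q(2) f]] .
    have "g \<cdot> n = Zer C N M"
      unfolding s(3)[symmetric] using g f Q(1-3) K1(1)
      by (simp add: arrow_simps Cmp_eq_assoc[OF g(2)])
    then obtain g' where g': "g' \<in> Hom C B M" "g' \<cdot> e1 = g" using N(7)[OF g(1)] by blast
    have "(g' \<cdot> k') \<cdot> q = f \<cdot> q"
      using g'(1) B(1) Q(2) N(2) K1(1) s(4) g(2) g'(2) Cmp_Cmp[OF K1(1) N(2) g'(1,2)]
        Cmp_assoc[OF Q(2) B(1) g'(1)] by simp
    then have "g' \<cdot> k' = f" using epicD[OF Q(5,2) Cmp_in_Hom[OF B(1) g'(1)] f] by blast
    then show "\<exists>g \<in> Hom C B M. g \<cdot> k' = f" using g' by blast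
  qed
qed

lemma ext_vanishes_retract:
  assumes "retract_modulo_projectives C G' G" "ext_vanishes C n G M"
  shows "ext_vanishes C n G' M"
  using assms
proof (induction n arbitrary: G G')
  case 0
  then have G: "G \<in> Obj C" "G' \<in> Obj C" using Hom_Obj unfolding retract_modulo_projectives_def by blast+
  obtain K k P p where P: "projective C P" "short_exact C K k P p G"
    using projective_cover[OF G(1)] .
  obtain K' k' P' p' where P': "projective C P'" "short_exact C K' k' P' p' G'"
    using projective_cover[OF G(2)] .
  have "extendable C k M" using 0(2) P(2) unfolding ext_vanishes.simps by blast
  then show ?case
    using ext_vanishes_0I[OF P'(2,1)] extendable_syzygy_transfer[OF P(2) P'(2) P(1) P'(1) 0(1)] by blast
next
  case (Suc n)
  then have G: "G \<in> Obj C" "G' \<in> Obj C" using Hom_Obj unfolding retract_modulo_projectives_def by blast+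
  obtain L k P p where P: "projective C P" "short_exact C L k P p G"
    using projective_cover[OF G(1)] .
  have L: "ext_vanishes C n L M" using Suc.prems(2) P unfolding ext_vanishes.simps by blast
  have "ext_vanishes C n L' M" if "short_exact C L' k' P' p' G'" "projective C P'" for L' k' P' p'
    using Suc.IH[OF retract_modulo_projectives_syzygy[OF P(2) that(1) P(1) that(2) Suc.prems(1)] L] .
  then show ?case unfolding ext_vanishes.simps by blast
qed

text \<open>
  Dimension shifting: the condition may be checked on a single syzygy.
\<close>

lemma ext_vanishes_Suc_iff:
  assumes S: "short_exact C K k P p G" and P: "projective C P"
  shows "ext_vanishes C (Suc n) G M \<longleftrightarrow> ext_vanishes C n K M"
proof
  show "ext_vanishes C (Suc n) G M \<Longrightarrow> ext_vanishes C n K M"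
    using assms unfolding ext_vanishes.simps by blast
  assume K: "ext_vanishes C n K M"
  have r: "retract_modulo_projectives C G G"
    using retract_modulo_projectives_refl short_exact_Obj[OF S] by blast
  have "ext_vanishes C n K' M" if "short_exact C K' k' P' p' G" "projective C P'" for K' k' P' p'
    using ext_vanishes_retract[OF retract_modulo_projectives_syzygy[OF S that(1) P that(2) r] K] .
  then show "ext_vanishes C (Suc n) G M" unfolding ext_vanishes.simps by blast
qed

lemma projective_biproduct:
  assumes P: "projective C P1" "projective C P2"
    and i: "i1 \<in> Hom C P1 S" "i2 \<in> Hom C P2 S" "p1 \<in> Hom C S P1" "p2 \<in> Hom C S P2"
    and sum: "Add C (i1 \<cdot> p1) (i2 \<cdot> p2) = Idt C S"
  shows "projective C S"
  unfolding projective_def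
proof (intro conjI allI impI ballI)
  show "S \<in> Obj C" using i Hom_Obj by blast
  fix e f assume e: "epic C e" and f: "f \<in> Hom C S (Cod C e)"
  have eH: "e \<in> Hom C (Dom C e) (Cod C e)" using e by (simp add: epic_def Hom_iff)
  obtain g1 where g1: "g1 \<in> Hom C P1 (Dom C e)" "e \<cdot> g1 = f \<cdot> i1"
    using projective_lift[OF P(1) e eH Cmp_in_Hom[OF i(1) f]] .
  obtain g2 where g2: "g2 \<in> Hom C P2 (Dom C e)" "e \<cdot> g2 = f \<cdot> i2"
    using projective_lift[OF P(2) e eH Cmp_in_Hom[OF i(2) f]] .
  have "e \<cdot> Add C (g1 \<cdot> p1) (g2 \<cdot> p2) = f \<cdot> Add C (i1 \<cdot> p1) (i2 \<cdot> p2)"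
    using g1 g2 i eH f by (simp add: arrow_simps Cmp_eq_assoc[OF g1(2)] Cmp_eq_assoc[OF g2(2)])
  also have "\<dots> = f" unfolding sum using Cmp_Idt_right f by simp
  finally show "\<exists>g \<in> Hom C S (Dom C e). e \<cdot> g = f"
    using Add_in_Hom[OF Cmp_in_Hom[OF i(3) g1(1)] Cmp_in_Hom[OF i(4) g2(1)]] by blast
qed

text \<open>
  The projective object over \<open>B\<close> is the sum of \<open>PA\<close> and \<open>PD\<close>, mapped by \<open>i \<cdot> a\<close> on the first summand and
  by a lift \<open>d'\<close> of \<open>d\<close> on the second. The last two conclusions record the square relating the kernels
  of the first and the second column.
\<close>

lemma horseshoe:
  assumes S: "short_exact C A i B p D"
    and SA: "short_exact C KA kA PA a A" and SD: "short_exact C KD kD PD d D"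
    and P: "projective C PA" "projective C PD"
  obtains KB kB PB b j q \<iota> where "short_exact C KB kB PB b B" "projective C PB"
    "short_exact C KA j KB q KD" "\<iota> \<in> Hom C PA PB" "kB \<cdot> j = \<iota> \<cdot> kA"
proof -
  note S = short_exactD[OF S] and SA = short_exactD[OF SA] and SD = short_exactD[OF SD]
  obtain d' where d': "d' \<in> Hom C PD B" "p \<cdot> d' = d" using projective_lift[OF P(2) S(5,2) SD(2)] .
  have PO: "PA \<in> Obj C" "PD \<in> Obj C" using P by (auto simp: projective_def)
  obtain PB i1 i2 p1 p2 where b: "i1 \<in> Hom C PA PB" "i2 \<in> Hom C PD PB" "p1 \<in> Hom C PB PA"
    "p2 \<in> Hom C PB PD"
    "p1 \<cdot> i1 = Idt C PA" "p2 \<cdot> i2 = Idt C PD" "p1 \<cdot> i2 = Zer C PD PA" "p2 \<cdot> i1 = Zer C PA PD"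
    "Add C (i1 \<cdot> p1) (i2 \<cdot> p2) = Idt C PB"
    using has_biproduct[OF PO] unfolding biproduct_def by blast
  have proj: "projective C PB" using projective_biproduct[OF P b(1-4,9)] .
  define e where "e = Add C (i \<cdot> (a \<cdot> p1)) (d' \<cdot> p2)"
  have e: "e \<in> Hom C PB B" using S(1) SA(2) b(1-4) d'(1) by (simp add: e_def arrow_simps)
  have ei1: "e \<cdot> i1 = i \<cdot> a" using S(1) SA(2) b d'(1) by (simp add: e_def arrow_simps)
  have ei2: "e \<cdot> i2 = d'" using S(1) SA(2) b d'(1) by (simp add: e_def arrow_simps)
  have pe: "p \<cdot> e = d \<cdot> p2"
    using S(1-3) SA(2) b(1-4) d' SD(2)
    by (simp add: e_def arrow_simps Cmp_eq_assoc[OF S(3)] Cmp_eq_assoc[OF d'(2)])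
  have epic_e: "epic C e"
  proof (rule epicI_zero[OF e])
    fix E w assume w: "w \<in> Hom C B E" "w \<cdot> e = Zer C PB E"
    have "(w \<cdot> i) \<cdot> a = w \<cdot> (e \<cdot> i1)" unfolding ei1 using Cmp_assoc[OF SA(2) S(1) w(1)] .
    also have "\<dots> = Zer C PA E"
      using w(1) e b(1) by (simp add: arrow_simps Cmp_eq_assoc[OF w(2)])
    finally have "w \<cdot> i = Zer C A E" using epic_zero[OF SA(5,2) Cmp_in_Hom[OF S(1) w(1)]] by blast
    then obtain w' where w': "w' \<in> Hom C D E" "w' \<cdot> p = w" using S(7)[OF w(1)] by blast
    have "w' \<cdot> d = w \<cdot> (e \<cdot> i2)"
      unfolding ei2 w'(2)[symmetric] d'(2)[symmetric]
      using Cmp_assoc[OF d'(1) S(2) w'(1)] by simp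
    also have "\<dots> = Zer C PD E"
      using w(1) e b(2) by (simp add: arrow_simps Cmp_eq_assoc[OF w(2)])
    finally have "w' = Zer C D E" using epic_zero[OF SD(5,2) w'(1)] by blast
    then show "w = Zer C B E" using w'(2) w(1) S(2) by (auto simp: Hom_iff Cmp_Zer_left)
  qed
  obtain KB kB where SB: "short_exact C KB kB PB e B" using epic_short_exact[OF epic_e e] by blast
  note K = short_exactD[OF SB]
  have dpk: "d \<cdot> (p2 \<cdot> kB) = Zer C KB D"
    using pe K(1-3) S(2) b(4) SD(2) Cmp_assoc[OF K(1) b(4) SD(2)] Cmp_assoc[OF K(1) e S(2)]
    by (simp add: arrow_simps)
  obtain q where q: "q \<in> Hom C KB KD" "kD \<cdot> q = p2 \<cdot> kB"
    using SD(6)[OF Cmp_in_Hom[OF K(1) b(4)] dpk] by blast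
  have "e \<cdot> (i1 \<cdot> kA) = Zer C KA B"
    using e b(1) S(1) SA(1-3) by (simp add: arrow_simps Cmp_eq_assoc[OF ei1])
  then obtain j where j: "j \<in> Hom C KA KB" "kB \<cdot> j = i1 \<cdot> kA"
    using K(6)[OF Cmp_in_Hom[OF SA(1) b(1)]] by blast
  have mi1: "monic C i1"
  proof (rule monicI_zero[OF b(1)])
    fix E g assume g: "g \<in> Hom C E PA" "i1 \<cdot> g = Zer C E PB"
    have "g = p1 \<cdot> (i1 \<cdot> g)" using g(1) b(1,3) by (simp add: arrow_simps Cmp_eq_assoc[OF b(5)])
    also have "\<dots> = Zer C E PA" using g b(3) by (simp add: arrow_simps)
    finally show "g = Zer C E PA" .
  qed
  have "short_exact C KA j KB q KD"
  proof (rule short_exactI[OF j(1) q(1)])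
    have "kD \<cdot> (q \<cdot> j) = Zer C KA PD"
      using j q b SD(1) K(1) SA(1)
      by (simp add: arrow_simps Cmp_eq_assoc[OF q(2)] Cmp_eq_assoc[OF b(8)])
    then show "q \<cdot> j = Zer C KA KD" using monic_zero[OF SD(4,1) Cmp_in_Hom[OF j(1) q(1)]] by blast
    have "monic C (i1 \<cdot> kA)" using monic_Cmp[OF SA(1) b(1) SA(4) mi1] .
    then show "monic C j" using monic_cancel[OF j(1) K(1)] j(2) by simp
    show "epic C q"
    proof (rule epicI_projective_lift[OF q(1)])
      fix T z assume z: "projective C T" "z \<in> Hom C T KD"
      have "p \<cdot> (d' \<cdot> (kD \<cdot> z)) = Zer C T D"
        using z d' S(2) SD(1-3)
        by (simp add: arrow_simps Cmp_eq_assoc[OF d'(2)] Cmp_eq_assoc[OF SD(3)])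
      then obtain y where y: "y \<in> Hom C T A" "i \<cdot> y = d' \<cdot> (kD \<cdot> z)"
        using S(6)[OF Cmp_in_Hom[OF Cmp_in_Hom[OF z(2) SD(1)] d'(1)]] by blast
      obtain y' where y': "y' \<in> Hom C T PA" "a \<cdot> y' = y"
        using projective_lift[OF z(1) SA(5,2) y(1)] .
      have i1y: "i1 \<cdot> y' \<in> Hom C T PB" and i2z: "i2 \<cdot> (kD \<cdot> z) \<in> Hom C T PB"
        using Cmp_in_Hom[OF y'(1) b(1)] Cmp_in_Hom[OF Cmp_in_Hom[OF z(2) SD(1)] b(2)] .
      \<comment> \<open>The element \<open>(0, kD \<cdot> z)\<close> of \<open>PB\<close> is sent into the image of \<open>A\<close>; subtracting \<open>y'\<close> on the
          first summand moves it into \<open>KB\<close>.\<close>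
      obtain x0 where x0: "x0 \<in> Hom C T PB" "Add C (i1 \<cdot> y') x0 = i2 \<cdot> (kD \<cdot> z)"
        using exists_difference[OF i2z i1y] by blast
      have ey: "e \<cdot> (i1 \<cdot> y') = i \<cdot> y"
        using e b(1) y' S(1) SA(2) by (simp add: arrow_simps Cmp_eq_assoc[OF ei1])
      have ez: "e \<cdot> (i2 \<cdot> (kD \<cdot> z)) = i \<cdot> y"
        using e b(2) z(2) SD(1) y(2) by (simp add: arrow_simps Cmp_eq_assoc[OF ei2])
      have "Add C (i \<cdot> y) (e \<cdot> x0) = i \<cdot> y"
        using Cmp_Add_right[OF i1y x0(1) e] unfolding x0(2) ey ez by simp
      then have "e \<cdot> x0 = Zer C T B"
        using Add_cancel_Zer[OF Cmp_in_Hom[OF y(1) S(1)] Cmp_in_Hom[OF x0(1) e]] by blast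
      then obtain x where x: "x \<in> Hom C T KB" "kB \<cdot> x = x0" using K(6)[OF x0(1)] by blast
      have "p2 \<cdot> Add C (i1 \<cdot> y') x0 = p2 \<cdot> x0"
        using b(1,4) y'(1) x0(1) by (simp add: arrow_simps Cmp_eq_assoc[OF b(8)])
      moreover have "p2 \<cdot> (i2 \<cdot> (kD \<cdot> z)) = kD \<cdot> z"
        using b(2,4) z(2) SD(1) by (simp add: arrow_simps Cmp_eq_assoc[OF b(6)])
      ultimately have "p2 \<cdot> x0 = kD \<cdot> z" unfolding x0(2) by simp
      then have "kD \<cdot> (q \<cdot> x) = kD \<cdot> z"
        using x q SD(1) b(4) K(1) by (simp add: arrow_simps Cmp_eq_assoc[OF q(2)])
      then have "q \<cdot> x = z" using monicD[OF SD(4,1) Cmp_in_Hom[OF x(1) q(1)] z(2)] by blast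
      then show "\<exists>x \<in> Hom C T KB. q \<cdot> x = z" using x(1) by blast
    qed
    fix E x assume x: "x \<in> Hom C E KB" "q \<cdot> x = Zer C E KD"
    have kx: "kB \<cdot> x \<in> Hom C E PB" using Cmp_in_Hom[OF x(1) K(1)] .
    have "p2 \<cdot> (kB \<cdot> x) = (kD \<cdot> q) \<cdot> x" unfolding q(2) using Cmp_assoc[OF x(1) K(1) b(4)] by simp
    also have "\<dots> = Zer C E PD" using x q(1) SD(1) by (simp add: arrow_simps)
    finally have p2kx: "p2 \<cdot> (kB \<cdot> x) = Zer C E PD" .
    have "kB \<cdot> x = Add C (i1 \<cdot> p1) (i2 \<cdot> p2) \<cdot> (kB \<cdot> x)" unfolding b(9)
      using Cmp_Idt_left[OF kx] by simp
    also have "\<dots> = Add C (i1 \<cdot> (p1 \<cdot> (kB \<cdot> x))) (i2 \<cdot> (p2 \<cdot> (kB \<cdot> x)))"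
      using x(1) K(1) b(1-4) by (simp add: arrow_simps)
    also have "\<dots> = i1 \<cdot> (p1 \<cdot> (kB \<cdot> x))"
      unfolding p2kx using x(1) K(1) b(1-4) by (simp add: arrow_simps)
    finally have kx1: "kB \<cdot> x = i1 \<cdot> (p1 \<cdot> (kB \<cdot> x))" .
    define y where "y = p1 \<cdot> (kB \<cdot> x)"
    have y: "y \<in> Hom C E PA" unfolding y_def using Cmp_in_Hom[OF kx b(3)] .
    have kxy: "kB \<cdot> x = i1 \<cdot> y" using kx1 y_def by simp
    have "i \<cdot> (a \<cdot> y) = e \<cdot> (kB \<cdot> x)"
      unfolding kxy using y e b(1) S(1) SA(2) by (simp add: arrow_simps Cmp_eq_assoc[OF ei1])
    also have "\<dots> = Zer C E B" using x(1) K(1-3) by (simp add: arrow_simps Cmp_eq_assoc[OF K(3)])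
    finally have "a \<cdot> y = Zer C E A" using monic_zero[OF S(4,1) Cmp_in_Hom[OF y SA(2)]] by blast
    then obtain h where h: "h \<in> Hom C E KA" "kA \<cdot> h = y" using SA(6)[OF y] by blast
    have "kB \<cdot> (j \<cdot> h) = kB \<cdot> x"
      unfolding kxy using h j K(1) b(1) SA(1) by (simp add: arrow_simps Cmp_eq_assoc[OF j(2)])
    then have "j \<cdot> h = x" using monicD[OF K(4,1) Cmp_in_Hom[OF h(1) j(1)] x(1)] by blast
    then show "\<exists>h \<in> Hom C E KA. j \<cdot> h = x" using h(1) by blast
  qed
  then show thesis using that SB proj b(1) j(2) by blast
qed


section \<open>The long exact sequence\<close>

text \<open>
  In degree one, an arrow from the kernel of \<open>E \<rightarrow> B\<close> is extended in two steps: first to the kernel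
  \<open>A'\<close> of \<open>E \<rightarrow> D\<close>, where the obstruction lies in \<open>Ext\<^sup>1(A, M)\<close>, then to \<open>E\<close>, with obstruction in
  \<open>Ext\<^sup>1(D, M)\<close>. Higher degrees follow from the sequence of syzygies.
\<close>

lemma ext_vanishes_middle:
  assumes "short_exact C A i B p D" "ext_vanishes C n A M" "ext_vanishes C n D M"
  shows "ext_vanishes C n B M"
  using assms
proof (induction n arbitrary: A i B p D)
  case 0
  have "extendable C n M" if E: "short_exact C N n E e B" for N n E e
  proof (rule extendableI[OF short_exactD(1)[OF E]])
    fix f assume f: "f \<in> Hom C N M"
    obtain A' k j q where s: "short_exact C A' k E (p \<cdot> e) D" "short_exact C N j A' q A"
      "k \<cdot> j = n" "i \<cdot> q = e \<cdot> k"
      using short_exact_Cmp[OF E 0(1)] .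
    have ex: "extendable C j M" "extendable C k M"
      using 0(2,3) s(1,2) unfolding ext_vanishes.simps by blast+
    note k = short_exactD(1)[OF s(1)] and j = short_exactD(1)[OF s(2)]
    obtain f1 where f1: "f1 \<in> Hom C A' M" "f1 \<cdot> j = f" using extendableD[OF ex(1) j f] .
    obtain f2 where f2: "f2 \<in> Hom C E M" "f2 \<cdot> k = f1" using extendableD[OF ex(2) k f1(1)] .
    have "f2 \<cdot> n = f" using Cmp_Cmp[OF j k f2] f1(2) s(3) by simp
    then show "\<exists>g \<in> Hom C E M. g \<cdot> n = f" using f2(1) by blast
  qed
  then show ?case unfolding ext_vanishes.simps by blast
next
  case (Suc n)
  obtain KA kA PA a where A: "projective C PA" "short_exact C KA kA PA a A"
    using projective_cover short_exact_Obj Suc.prems(1) by metis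
  obtain KD kD PD d where D: "projective C PD" "short_exact C KD kD PD d D"
    using projective_cover short_exact_Obj Suc.prems(1) by metis
  obtain KB kB PB b j q \<iota> where B: "short_exact C KB kB PB b B" "projective C PB"
    "short_exact C KA j KB q KD"
    using horseshoe[OF Suc.prems(1) A(2) D(2) A(1) D(1)] .
  have "ext_vanishes C n KA M" "ext_vanishes C n KD M"
    using Suc.prems(2,3) ext_vanishes_Suc_iff A D by blast+
  then show ?case using Suc.IH[OF B(3)] ext_vanishes_Suc_iff[OF B(1,2)] by blast
qed

text \<open>
  The syzygy of \<open>D\<close> obtained from a projective object over \<open>B\<close> is an extension of \<open>A\<close> by the syzygy of
  \<open>B\<close>.
\<close>

lemma ext_vanishes_quotient:
  assumes S: "short_exact C A i B p D" and A: "ext_vanishes C n A M"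
    and B: "ext_vanishes C (Suc n) B M"
  shows "ext_vanishes C (Suc n) D M"
proof -
  obtain N n' P e where P: "projective C P" "short_exact C N n' P e B"
    using projective_cover short_exact_Obj S by metis
  obtain A' k j q where s: "short_exact C A' k P (p \<cdot> e) D" "short_exact C N j A' q A"
    using short_exact_Cmp[OF P(2) S] .
  have "ext_vanishes C n N M" using B ext_vanishes_Suc_iff P by blast
  then have "ext_vanishes C n A' M" using ext_vanishes_middle[OF s(2)] A by blast
  then show ?thesis using ext_vanishes_Suc_iff[OF s(1) P(1)] by blast
qed

text \<open>
  In degree one, an arrow from the syzygy of \<open>A\<close> extends to the syzygy of \<open>B\<close>, because the quotient is
  the syzygy of \<open>D\<close>, whose \<open>Ext\<^sup>1\<close> vanishes. It then extends to the projective object over \<open>B\<close>, and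
  is restricted to the one over \<open>A\<close>.
\<close>

lemma ext_vanishes_sub:
  assumes "short_exact C A i B p D" "ext_vanishes C n B M" "ext_vanishes C (Suc n) D M"
  shows "ext_vanishes C n A M"
  using assms
proof (induction n arbitrary: A i B p D)
  case 0
  obtain KA kA PA a where A: "projective C PA" "short_exact C KA kA PA a A"
    using projective_cover short_exact_Obj 0(1) by metis
  obtain KD kD PD d where D: "projective C PD" "short_exact C KD kD PD d D"
    using projective_cover short_exact_Obj 0(1) by metis
  obtain KB kB PB b j q \<iota> where B: "short_exact C KB kB PB b B" "projective C PB"
    "short_exact C KA j KB q KD" "\<iota> \<in> Hom C PA PB" "kB \<cdot> j = \<iota> \<cdot> kA"
    using horseshoe[OF 0(1) A(2) D(2) A(1) D(1)] .
  note kA = short_exactD(1)[OF A(2)] and kB = short_exactD(1)[OF B(1)] and j = short_exactD(1)[OF B(3)]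
  have "ext_vanishes C 0 KD M" using 0(3) ext_vanishes_Suc_iff[OF D(2,1)] by blast
  then have ex: "extendable C j M" "extendable C kB M"
    using B(1,3) 0(2) unfolding ext_vanishes.simps by blast+
  have "extendable C kA M"
  proof (rule extendableI[OF kA])
    fix f assume f: "f \<in> Hom C KA M"
    obtain f1 where f1: "f1 \<in> Hom C KB M" "f1 \<cdot> j = f" using extendableD[OF ex(1) j f] .
    obtain f2 where f2: "f2 \<in> Hom C PB M" "f2 \<cdot> kB = f1" using extendableD[OF ex(2) kB f1(1)] .
    have "(f2 \<cdot> \<iota>) \<cdot> kA = f2 \<cdot> (kB \<cdot> j)" unfolding B(5) using Cmp_assoc[OF kA B(4) f2(1)] .
    also have "\<dots> = f" using Cmp_Cmp[OF j kB f2] f1(2) by simp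
    finally show "\<exists>g \<in> Hom C PA M. g \<cdot> kA = f" using Cmp_in_Hom[OF B(4) f2(1)] by blast
  qed
  then show ?case using ext_vanishes_0I[OF A(2,1)] by blast
next
  case (Suc n)
  obtain KA kA PA a where A: "projective C PA" "short_exact C KA kA PA a A"
    using projective_cover short_exact_Obj Suc.prems(1) by metis
  obtain KD kD PD d where D: "projective C PD" "short_exact C KD kD PD d D"
    using projective_cover short_exact_Obj Suc.prems(1) by metis
  obtain KB kB PB b j q \<iota> where B: "short_exact C KB kB PB b B" "projective C PB"
    "short_exact C KA j KB q KD"
    using horseshoe[OF Suc.prems(1) A(2) D(2) A(1) D(1)] .
  have "ext_vanishes C n KB M" "ext_vanishes C (Suc n) KD M"
    using Suc.prems(2,3) ext_vanishes_Suc_iff B(1,2) D by blast+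
  then show ?case using Suc.IH[OF B(3)] ext_vanishes_Suc_iff[OF A(2,1)] by blast
qed

lemma ext_vanishes_iso:
  assumes f: "f \<in> Hom C A B" "monic C f" "epic C f"
  shows "ext_vanishes C n A M \<longleftrightarrow> ext_vanishes C n B M"
proof -
  obtain g where g: "g \<in> Hom C B A" "g \<cdot> f = Idt C A" "f \<cdot> g = Idt C B"
    using monic_epic_iso[OF f] by blast
  show ?thesis
    using ext_vanishes_retract retract_modulo_projectives_if_retract[OF f(1) g(1,2)]
      retract_modulo_projectives_if_retract[OF g(1) f(1) g(3)] by blast
qed

text \<open>
  A section of \<open>p\<close> yields a retraction of \<open>k\<close>, along which every arrow extends.
\<close>

lemma projective_ext_vanishes_0:
  assumes P: "projective C P"
  shows "ext_vanishes C 0 P M"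
  unfolding ext_vanishes.simps
proof (intro allI impI)
  fix K k B p assume s: "short_exact C K k B p P"
  note S = short_exactD[OF s]
  have PO: "P \<in> Obj C" "B \<in> Obj C" using short_exact_Obj[OF s] by auto
  obtain s where s: "s \<in> Hom C P B" "p \<cdot> s = Idt C P"
    using projective_lift[OF P S(5,2) Idt_in_Hom[OF PO(1)]] .
  obtain e where e: "e \<in> Hom C B B" "Add C (s \<cdot> p) e = Idt C B"
    using exists_difference[OF Idt_in_Hom[OF PO(2)] Cmp_in_Hom[OF S(2) s(1)]] by blast
  have "Add C p (p \<cdot> e) = p \<cdot> Add C (s \<cdot> p) e"
    using s e(1) S(2) by (simp add: arrow_simps Cmp_eq_assoc[OF s(2)])
  also have "\<dots> = p" unfolding e(2) using Cmp_Idt_right S(2) by blast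
  finally have "p \<cdot> e = Zer C B P" using Add_cancel_Zer[OF S(2) Cmp_in_Hom[OF e(1) S(2)]] by blast
  then obtain r where r: "r \<in> Hom C B K" "k \<cdot> r = e" using S(6)[OF e(1)] by blast
  have "k = Add C (s \<cdot> p) e \<cdot> k" unfolding e(2) using Cmp_Idt_left S(1) by simp
  also have "\<dots> = k \<cdot> (r \<cdot> k)"
    unfolding r(2)[symmetric] using S(1-3) s(1) r(1) by (simp add: arrow_simps)
  finally have "k \<cdot> (r \<cdot> k) = k \<cdot> Idt C K" using Cmp_Idt_right S(1) by simp
  then have rk: "r \<cdot> k = Idt C K"
    using monicD[OF S(4,1) Cmp_in_Hom[OF S(1) r(1)] Idt_in_Hom] Hom_Obj(1)[OF S(1)] by blast
  show "extendable C k M"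
  proof (rule extendableI[OF S(1)])
    fix f assume f: "f \<in> Hom C K M"
    have "(f \<cdot> r) \<cdot> k = f" using f rk r(1) S(1) by (simp add: arrow_simps)
    then show "\<exists>g \<in> Hom C B M. g \<cdot> k = f" using Cmp_in_Hom[OF r(1) f] by blast
  qed
qed

text \<open>
  Extend the identity of \<open>K\<close> to a retraction \<open>r\<close> of \<open>k\<close>. Then \<open>1 - k \<cdot> r\<close> kills \<open>k\<close>, so it factors as
  \<open>t \<cdot> p\<close>, and \<open>t\<close> is the second injection. The object \<open>G\<close> comes first, since closure under summands is
  formulated for the first summand.
\<close>

lemma short_exact_splits:
  assumes s: "short_exact C K k B p G" and e: "ext_vanishes C 0 G K"
  shows "biproduct C G K B"
proof -
  note S = short_exactD[OF s]
  have O: "K \<in> Obj C" "B \<in> Obj C" "G \<in> Obj C" using short_exact_Obj[OF s] by auto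
  have "extendable C k K" using s e unfolding ext_vanishes.simps by blast
  then obtain r where r: "r \<in> Hom C B K" "r \<cdot> k = Idt C K"
    using extendableD[OF _ S(1) Idt_in_Hom[OF O(1)]] by blast
  have kr: "k \<cdot> r \<in> Hom C B B" using Cmp_in_Hom[OF r(1) S(1)] .
  obtain e where e: "e \<in> Hom C B B" "Add C (k \<cdot> r) e = Idt C B"
    using exists_difference[OF Idt_in_Hom[OF O(2)] kr] by blast
  have "Add C k (e \<cdot> k) = Add C (k \<cdot> r) e \<cdot> k"
    using r e(1) S(1) by (simp add: arrow_simps)
  also have "\<dots> = k" unfolding e(2) using Cmp_Idt_left S(1) by blast
  finally have "e \<cdot> k = Zer C K B" using Add_cancel_Zer[OF S(1) Cmp_in_Hom[OF S(1) e(1)]] by blast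
  then obtain t where t: "t \<in> Hom C G B" "t \<cdot> p = e" using S(7)[OF e(1)] by blast
  have "(p \<cdot> t) \<cdot> p = p \<cdot> Add C (k \<cdot> r) e"
    unfolding t(2)[symmetric] using S(1-3) r(1) t(1)
    by (simp add: arrow_simps Cmp_eq_assoc[OF S(3)])
  also have "\<dots> = Idt C G \<cdot> p" unfolding e(2) using Cmp_Idt_right Cmp_Idt_left S(2) by simp
  finally have pt: "p \<cdot> t = Idt C G"
    using epicD[OF S(5,2) Cmp_in_Hom[OF t(1) S(2)] Idt_in_Hom[OF O(3)]] by blast
  have "Add C r (r \<cdot> e) = r \<cdot> Add C (k \<cdot> r) e"
    using S(1) r e(1) by (simp add: arrow_simps Cmp_eq_assoc[OF r(2)])
  also have "\<dots> = r" unfolding e(2) using Cmp_Idt_right r(1) by simp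
  finally have re: "r \<cdot> e = Zer C B K" using Add_cancel_Zer[OF r(1) Cmp_in_Hom[OF e(1) r(1)]] by blast
  have "(r \<cdot> t) \<cdot> p = Zer C B K" using re t Cmp_assoc[OF S(2) t(1) r(1)] by simp
  then have rt: "r \<cdot> t = Zer C G K" using epic_zero[OF S(5,2) Cmp_in_Hom[OF t(1) r(1)]] by blast
  have "Add C (t \<cdot> p) (k \<cdot> r) = Idt C B"
    using e kr unfolding t(2) by (simp add: Add_commute Hom_iff)
  then show ?thesis using O S(1-3) r t(1) pt rt unfolding biproduct_def by blast
qed

section \<open>Comparison with the Ext groups\<close>

text \<open>
  Removing \<open>X 0\<close> from a resolution of \<open>G\<close> leaves a resolution of the syzygy \<open>Z\<close>.
\<close>

lemma exact_left_shift:
  assumes "exact_left C X d G"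
  obtains Z m e where "short_exact C Z m (X 0) (d 0) G" "e \<in> Hom C (X 1) Z" "epic C e" "m \<cdot> e = d 1"
    "exact_left C (\<lambda>i. X (Suc i)) (\<lambda>i. if i = 0 then e else d (Suc i)) Z"
proof -
  have d: "d 0 \<in> Hom C (X 0) G" "\<And>i. d (Suc i) \<in> Hom C (X (Suc i)) (X i)" "epic C (d 0)"
    "\<And>i. exact_at C (d (Suc i)) (d i)"
    using assms by (auto simp: exact_left_def)
  obtain Z m where s: "short_exact C Z m (X 0) (d 0) G" using epic_short_exact[OF d(3,1)] by blast
  then have m: "is_kernel C m (d 0)" "m \<in> Hom C Z (X 0)" by (simp_all add: short_exact_iff)
  obtain e where e: "e \<in> Hom C (X 1) Z" "epic C e" "m \<cdot> e = d 1"
    using exact_at_epic_part[OF d(4) d(2) m] by auto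
  have "exact_at C (d 2) e"
    using exact_at_Cmp_monic[of "d 2" m e] d(4)[of 1] e m(2) short_exactD(4)[OF s]
    by (simp add: numeral_2_eq_2)
  then have "exact_left C (\<lambda>i. X (Suc i)) (\<lambda>i. if i = 0 then e else d (Suc i)) Z"
    using e d by (simp add: exact_left_def numeral_2_eq_2)
  then show thesis using that s e by blast
qed

text \<open>
  The epimorphism \<open>e\<close> is the cokernel of its own kernel, which is the image of \<open>h\<close>, and \<open>f\<close> vanishes on
  that image.
\<close>

lemma exact_at_colift:
  assumes ex: "exact_at C h e" and h: "h \<in> Hom C A B" and e: "e \<in> Hom C B D" "epic C e"
    and f: "f \<in> Hom C B M" "f \<cdot> h = Zer C A M"
  shows "\<exists>f' \<in> Hom C D M. f' \<cdot> e = f"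
proof -
  obtain m c where mc: "is_cokernel C c h" "is_kernel C m c" "is_kernel C m e"
    using ex by (auto simp: exact_at_def is_image_def)
  note Cd = is_cokernelD[OF mc(1) h]
  note K = is_kernelD[OF mc(2) Cd(1)]
  obtain y where y: "y \<in> Hom C (Cod C c) M" "y \<cdot> c = f" using Cd(4)[OF f] by blast
  have "f \<cdot> m = y \<cdot> (c \<cdot> m)" using y Cmp_assoc[OF K(1) Cd(1) y(1)] by simp
  also have "\<dots> = Zer C (Dom C m) M" unfolding K(2) using y(1) K(1) by (simp add: arrow_simps)
  finally show ?thesis
    using is_cokernelD(4)[OF cokernel_of_kernel[OF e(2,1) mc(3)] K(1) f(1)] Hom_Cod[OF e(1)] by blast
qed

lemma exact_at_zero:
  assumes ex: "exact_at C f g" and f: "f \<in> Hom C A B" and g: "g \<in> Hom C B D"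
  shows "g \<cdot> f = Zer C A D"
proof -
  obtain m where m: "is_kernel C m g" using ex by (auto simp: exact_at_def)
  note K = is_kernelD[OF m g]
  obtain e where e: "e \<in> Hom C A (Dom C m)" "m \<cdot> e = f"
    using exact_at_epic_part[OF ex f m K(1)] by blast
  then show ?thesis using Cmp_Cmp[OF e(1) K(1) g K(2)] g by (simp add: arrow_simps)
qed

text \<open>
  Cocycles in degree \<open>1\<close> are the arrows out of the first syzygy, because the resolution maps onto it,
  and coboundaries are those that extend to \<open>X 0\<close>. Higher degrees are degree \<open>1\<close> for the shifted
  resolution.
\<close>

lemma ext_vanishes_iff_resolution:
  assumes "exact_left C X d G" "\<And>i. projective C (X i)"
  shows "ext_vanishes C n G M \<longleftrightarrow>
    (\<forall>f \<in> Hom C (X (Suc n)) M. f \<cdot> d (Suc (Suc n)) = Zer C (X (Suc (Suc n))) M \<longrightarrow>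
       (\<exists>g \<in> Hom C (X n) M. g \<cdot> d (Suc n) = f))"
  using assms
proof (induction n arbitrary: X d G)
  case 0
  obtain Z m e where s: "short_exact C Z m (X 0) (d 0) G" "e \<in> Hom C (X 1) Z" "epic C e"
    "m \<cdot> e = d 1"
    "exact_left C (\<lambda>i. X (Suc i)) (\<lambda>i. if i = 0 then e else d (Suc i)) Z"
    using exact_left_shift[OF 0(1)] .
  have d2: "d 2 \<in> Hom C (X 2) (X 1)" "exact_at C (d 2) e"
    using s(5) unfolding exact_left_def by (auto simp: numeral_2_eq_2 dest: spec[of _ 0])
  note m = short_exactD(1)[OF s(1)]
  have "ext_vanishes C 0 G M \<longleftrightarrow> extendable C m M"
    using ext_vanishes_0I[OF s(1) 0(2)] s(1) unfolding ext_vanishes.simps by blast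
  also have "\<dots> \<longleftrightarrow> (\<forall>f \<in> Hom C (X 1) M. f \<cdot> d 2 = Zer C (X 2) M \<longrightarrow>
       (\<exists>g \<in> Hom C (X 0) M. g \<cdot> d 1 = f))" (is "_ \<longleftrightarrow> ?R")
  proof
    assume ex: "extendable C m M"
    show ?R
    proof (intro ballI impI)
      fix f assume f: "f \<in> Hom C (X 1) M" "f \<cdot> d 2 = Zer C (X 2) M"
      obtain f' where f': "f' \<in> Hom C Z M" "f' \<cdot> e = f"
        using exact_at_colift[OF d2(2,1) s(2,3) f] by blast
      obtain g where g: "g \<in> Hom C (X 0) M" "g \<cdot> m = f'" using extendableD[OF ex m f'(1)] .
      have "g \<cdot> d 1 = f" using Cmp_Cmp[OF s(2) m g] f' s(4) by simp
      then show "\<exists>g \<in> Hom C (X 0) M. g \<cdot> d 1 = f" using g(1) by blast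
    qed
  next
    assume R: ?R
    show "extendable C m M"
    proof (rule extendableI[OF m])
      fix f assume f: "f \<in> Hom C Z M"
      have "(f \<cdot> e) \<cdot> d 2 = Zer C (X 2) M"
        using f s(2) d2(1) exact_at_zero[OF d2(2,1) s(2)] by (simp add: arrow_simps)
      then obtain g where g: "g \<in> Hom C (X 0) M" "g \<cdot> d 1 = f \<cdot> e"
        using R Cmp_in_Hom[OF s(2) f] by blast
      have "(g \<cdot> m) \<cdot> e = f \<cdot> e" using g s(4) Cmp_assoc[OF s(2) m g(1)] by simp
      then have "g \<cdot> m = f" using epicD[OF s(3,2) Cmp_in_Hom[OF m g(1)] f] by blast
      then show "\<exists>g \<in> Hom C (X 0) M. g \<cdot> m = f" using g(1) by blast
    qed
  qed
  finally show ?case by (simp add: numeral_2_eq_2)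
next
  case (Suc n)
  obtain Z m e where s: "short_exact C Z m (X 0) (d 0) G" "e \<in> Hom C (X 1) Z" "epic C e"
    "m \<cdot> e = d 1"
    "exact_left C (\<lambda>i. X (Suc i)) (\<lambda>i. if i = 0 then e else d (Suc i)) Z"
    using exact_left_shift[OF Suc.prems(1)] .
  show ?case
    using ext_vanishes_Suc_iff[OF s(1) Suc.prems(2)] Suc.IH[OF s(5) Suc.prems(2)] by simp
qed

lemma trivial_Ext_iff_extension:
  assumes R: "exact_left C X d G" and M: "M \<in> Obj C" and c: "chosen_resolution C G = (X, d)"
  shows "trivial_group (Ext C (Suc n) G M) \<longleftrightarrow>
    (\<forall>f \<in> Hom C (X (Suc n)) M. f \<cdot> d (Suc (Suc n)) = Zer C (X (Suc (Suc n))) M \<longrightarrow>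
       (\<exists>g \<in> Hom C (X n) M. g \<cdot> d (Suc n) = f))"
proof -
  have d: "\<And>i. d (Suc i) \<in> Hom C (X (Suc i)) (X i)" "\<And>i. exact_at C (d (Suc i)) (d i)"
    using R by (auto simp: exact_left_def)
  have O: "\<And>i. X i \<in> Obj C" using d(1) Hom_Obj by blast
  have precomp: "group_hom (hom_group C (X i) M) (hom_group C (X (Suc i)) M) (\<lambda>f. f \<cdot> d (Suc i))" for i
    unfolding group_hom_def group_hom_axioms_def
    using hom_comm_group[OF O M] Cmp_in_Hom[OF d(1)] Cmp_Add_left[OF d(1)]
    by (auto simp: hom_def hom_group_simps comm_group_def)
  interpret H: comm_group "hom_group C (X (Suc n)) M" using hom_comm_group[OF O M] .
  interpret \<phi>: group_hom "hom_group C (X n) M" "hom_group C (X (Suc n)) M" "\<lambda>f. f \<cdot> d (Suc n)"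
    using precomp .
  interpret \<psi>: group_hom "hom_group C (X (Suc n)) M" "hom_group C (X (Suc (Suc n))) M"
    "\<lambda>f. f \<cdot> d (Suc (Suc n))" using precomp .
  define Zc where "Zc = cocycles C (X, d) M (Suc n)"
  define Bd where "Bd = coboundaries C (X, d) M (Suc n)"
  have Zc: "Zc = kernel (hom_group C (X (Suc n)) M) (hom_group C (X (Suc (Suc n))) M)
      (\<lambda>f. f \<cdot> d (Suc (Suc n)))"
    by (simp add: Zc_def cocycles_def)
  then have Zc_mem: "f \<in> Zc \<longleftrightarrow> f \<in> Hom C (X (Suc n)) M \<and> f \<cdot> d (Suc (Suc n)) = Zer C (X (Suc (Suc n))) M" for f
    by (simp add: kernel_def hom_group_simps)
  have Bd: "Bd = (\<lambda>f. f \<cdot> d (Suc n)) ` Hom C (X n) M"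
    by (simp add: Bd_def coboundaries_def)
  have sZ: "subgroup Zc (hom_group C (X (Suc n)) M)" unfolding Zc by (rule \<psi>.subgroup_kernel)
  have sB: "subgroup Bd (hom_group C (X (Suc n)) M)"
    using \<phi>.img_is_subgroup by (simp add: Bd hom_group_simps)
  have "Bd \<subseteq> Zc"
  proof
    fix f assume "f \<in> Bd"
    then obtain g where g: "g \<in> Hom C (X n) M" "f = g \<cdot> d (Suc n)" unfolding Bd by blast
    have "f \<cdot> d (Suc (Suc n)) = Zer C (X (Suc (Suc n))) M"
      unfolding g(2) using g(1) d(1)[of n] d(1)[of "Suc n"] exact_at_zero[OF d(2) d(1) d(1), of n]
      by (simp add: arrow_simps)
    then show "f \<in> Zc" using Zc_mem g Cmp_in_Hom[OF d(1) g(1)] by simp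
  qed
  then have sBZ: "subgroup Bd ((hom_group C (X (Suc n)) M)\<lparr>carrier := Zc\<rparr>)"
    using H.subgroup_incl[OF sB sZ] by blast
  interpret Z: comm_group "(hom_group C (X (Suc n)) M)\<lparr>carrier := Zc\<rparr>"
    by (rule group.group_comm_groupI[OF subgroup.subgroup_is_group[OF sZ H.is_group]])
      (simp add: H.m_comm subgroup.mem_carrier[OF sZ])
  have "trivial_group (Ext C (Suc n) G M) \<longleftrightarrow> Zc \<subseteq> Bd"
    using trivial_FactGroup_iff[OF Z.subgroup_imp_normal[OF sBZ]]
    by (simp add: Ext_def Let_def c Zc_def Bd_def)
  then show ?thesis using Zc_mem unfolding Bd by blast
qed

text \<open>
  The choice of a projective cover for every object is iterated, and the resulting short exact
  sequences are spliced.
\<close>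

lemma exists_projective_resolution:
  assumes G: "G \<in> Obj C"
  shows "\<exists>R. projective_resolution C G R"
proof -
  have "\<forall>A \<in> Obj C. \<exists>K k P p. projective C P \<and> short_exact C K k P p A"
    using projective_cover by metis
  then obtain K k P p where
    cov: "\<And>A. A \<in> Obj C \<Longrightarrow> projective C (P A)"
      "\<And>A. A \<in> Obj C \<Longrightarrow> short_exact C (K A) (k A) (P A) (p A) A"
    by metis
  define Z where "Z = (\<lambda>n. (K ^^ n) G)"
  have Z0: "Z 0 = G" and ZS: "\<And>n. Z (Suc n) = K (Z n)" by (simp_all add: Z_def)
  have ZO: "Z n \<in> Obj C" for n
  proof (induction n)
    case 0 then show ?case using G Z0 by simp
  next
    case (Suc n) then show ?case using short_exact_Obj[OF cov(2)[OF Suc]] ZS by simp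
  qed
  define d where "d = (\<lambda>i. case i of 0 \<Rightarrow> p G | Suc j \<Rightarrow> k (Z j) \<cdot> p (Z (Suc j)))"
  have s: "short_exact C (Z (Suc i)) (k (Z i)) (P (Z i)) (p (Z i)) (Z i)" for i
    using cov(2)[OF ZO] ZS by simp
  note S = short_exactD[OF s]
  have "exact_at C (d (Suc i)) (d i)" for i
  proof (cases i)
    case 0
    have "monic C (Idt C G)"
      using monicI_zero[OF Idt_in_Hom[OF G]] Cmp_Idt_left by simp
    then have "exact_at C (k (Z 0) \<cdot> p (Z (Suc 0))) (Idt C G \<cdot> p (Z 0))"
      using exact_at_Cmp[OF s[of 0] S(2,5)[of "Suc 0"]] Idt_in_Hom[OF G] Z0 by simp
    then show ?thesis using 0 Z0 S(2)[of 0] Cmp_Idt_left by (simp add: d_def)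
  next
    case (Suc j)
    have "exact_at C (k (Z i) \<cdot> p (Z (Suc i))) (k (Z j) \<cdot> p (Z i))"
      using exact_at_Cmp[OF s[of i] S(2,5)[of "Suc i"]] S(1,4)[of j] unfolding Suc by blast
    then show ?thesis by (simp add: d_def Suc)
  qed
  moreover have "d (Suc i) \<in> Hom C (P (Z (Suc i))) (P (Z i))" for i
    using Cmp_in_Hom[OF S(2)[of "Suc i"] S(1)[of i]] by (simp add: d_def)
  ultimately have "projective_resolution C G (\<lambda>i. P (Z i), d)"
    using cov(1)[OF ZO] S(2,5)[of 0] by (simp add: projective_resolution_def exact_left_def d_def Z0)
  then show ?thesis by blast
qed

text \<open>
  In this form the choice of a resolution in the definition of \<open>Ext\<close> has disappeared.
\<close>

lemma trivial_Ext_iff_ext_vanishes: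
  assumes G: "G \<in> Obj C" and M: "M \<in> Obj C"
  shows "trivial_group (Ext C (Suc n) G M) \<longleftrightarrow> ext_vanishes C n G M"
proof -
  obtain X d where c: "chosen_resolution C G = (X, d)" by force
  have "projective_resolution C G (X, d)"
    using someI_ex[OF exists_projective_resolution[OF G]] c by (simp add: chosen_resolution_def)
  then have "exact_left C X d G" "\<And>i. projective C (X i)" by (auto simp: projective_resolution_def)
  then show ?thesis
    using trivial_Ext_iff_extension[OF _ M c] ext_vanishes_iff_resolution[of X d G n M] by simp
qed

lemma right_perp_inf_iff:
  assumes "\<F> \<subseteq> Obj C"
  shows "M \<in> right_perp_inf C \<F> \<longleftrightarrow> M \<in> Obj C \<and> (\<forall>G \<in> \<F>. \<forall>n. ext_vanishes C n G M)"
proof -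
  have "M \<in> right_perp_inf C \<F> \<longleftrightarrow> M \<in> Obj C \<and> (\<forall>n. \<forall>G \<in> \<F>. trivial_group (Ext C (Suc n) G M))"
    unfolding right_perp_inf_def right_perp_def
    by (auto simp: Suc_le_eq) (metis Suc_le_eq gr0_conv_Suc order_refl)+
  then show ?thesis using trivial_Ext_iff_ext_vanishes assms by blast
qed

lemma left_perp_inf_iff:
  assumes "\<F> \<subseteq> Obj C"
  shows "M \<in> left_perp_inf C \<F> \<longleftrightarrow> M \<in> Obj C \<and> (\<forall>G \<in> \<F>. \<forall>n. ext_vanishes C n M G)"
proof -
  have "M \<in> left_perp_inf C \<F> \<longleftrightarrow> M \<in> Obj C \<and> (\<forall>n. \<forall>G \<in> \<F>. trivial_group (Ext C (Suc n) M G))"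
    unfolding left_perp_inf_def left_perp_def
    by (auto simp: Suc_le_eq) (metis Suc_le_eq gr0_conv_Suc order_refl)+
  then show ?thesis using trivial_Ext_iff_ext_vanishes assms by blast
qed

lemma right_perp_1_iff:
  assumes "\<F> \<subseteq> Obj C"
  shows "M \<in> right_perp C 1 \<F> \<longleftrightarrow> M \<in> Obj C \<and> (\<forall>G \<in> \<F>. ext_vanishes C 0 G M)"
proof -
  have "M \<in> right_perp C 1 \<F> \<longleftrightarrow> M \<in> Obj C \<and> (\<forall>G \<in> \<F>. trivial_group (Ext C (Suc 0) G M))"
    unfolding right_perp_def by (auto simp: le_antisym)
  then show ?thesis using trivial_Ext_iff_ext_vanishes assms by blast
qed


section \<open>Dimension shifting along exact sequences\<close>

lemma zero_object_Hom:
  assumes "zero_object C Z"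
  shows "f \<in> Hom C Z A \<Longrightarrow> f = Zer C Z A" "f \<in> Hom C A Z \<Longrightarrow> f = Zer C A Z"
proof -
  have Z: "Z \<in> Obj C" using assms by (simp add: zero_object_def)
  show "f = Zer C Z A" if "f \<in> Hom C Z A"
    using assms that Zer_in_Hom[OF Z Hom_Obj(2)[OF that]] Hom_Obj(2)[OF that]
    unfolding zero_object_def by blast
  show "f = Zer C A Z" if "f \<in> Hom C A Z"
    using assms that Zer_in_Hom[OF Hom_Obj(1)[OF that] Z] Hom_Obj(1)[OF that]
    unfolding zero_object_def by blast
qed

lemma zero_object_projective:
  assumes Z: "zero_object C Z"
  shows "projective C Z"
  unfolding projective_def
proof (intro conjI allI impI ballI)
  show ZO: "Z \<in> Obj C" using Z by (simp add: zero_object_def)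
  fix e f assume e: "epic C e" and f: "f \<in> Hom C Z (Cod C e)"
  have eA: "e \<in> Arr C" using e by (simp add: epic_def)
  have "e \<cdot> Zer C Z (Dom C e) = f"
    using zero_object_Hom(1)[OF Z f] eA ZO by (simp add: arrow_simps)
  then show "\<exists>g \<in> Hom C Z (Dom C e). e \<cdot> g = f" using Zer_in_Hom[OF ZO] eA by auto
qed

lemma monic_from_zero:
  assumes Z: "zero_object C Z" and A: "A \<in> Obj C"
  shows "monic C (Zer C Z A)"
proof (rule monicI_zero)
  show "Zer C Z A \<in> Hom C Z A" using Z A Zer_in_Hom by (simp add: zero_object_def)
qed (rule zero_object_Hom(2)[OF Z])

lemma epic_to_zero:
  assumes Z: "zero_object C Z" and A: "A \<in> Obj C"
  shows "epic C (Zer C A Z)"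
proof (rule epicI_zero)
  show "Zer C A Z \<in> Hom C A Z" using Z A Zer_in_Hom by (simp add: zero_object_def)
qed (rule zero_object_Hom(1)[OF Z])

text \<open>
  Passing from the syzygy to \<open>G\<close> raises the degree from which Ext vanishes by one. For \<open>n = 0\<close> the
  arrow \<open>d 0\<close> is an isomorphism.
\<close>

lemma resolution_ext_vanishes:
  assumes "exact_left C X d G" "\<And>i j. ext_vanishes C j (X i) M" "\<And>i. i > n \<Longrightarrow> zero_object C (X i)"
    "n \<le> j"
  shows "ext_vanishes C j G M"
  using assms
proof (induction n arbitrary: X d G j)
  case 0
  obtain Z m e where s: "short_exact C Z m (X 0) (d 0) G" "e \<in> Hom C (X 1) Z" "epic C e"
    "m \<cdot> e = d 1"
    using exact_left_shift[OF 0(1)] .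
  note S = short_exactD[OF s(1)]
  have "m \<cdot> e = Zer C (X 1) (X 0)"
    using zero_object_Hom(1)[OF 0(3)[of 1]] Cmp_in_Hom[OF s(2) S(1)] by simp
  then have m0: "m = Zer C Z (X 0)" using epic_zero[OF s(3,2) S(1)] by blast
  have "monic C (d 0)"
  proof (rule monicI_zero[OF S(2)])
    fix A g assume g: "g \<in> Hom C A (X 0)" "d 0 \<cdot> g = Zer C A G"
    then obtain h where h: "h \<in> Hom C A Z" "m \<cdot> h = g" using S(6) by blast
    have "m \<cdot> h = Zer C A (X 0)" unfolding m0 using h(1) g(1) by (simp add: arrow_simps)
    then show "g = Zer C A (X 0)" using h(2) by simp
  qed
  then show ?case using ext_vanishes_iso[OF S(2) _ S(5)] 0(2) by blast
next
  case (Suc n)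
  obtain Z m e where s: "short_exact C Z m (X 0) (d 0) G"
    "exact_left C (\<lambda>i. X (Suc i)) (\<lambda>i. if i = 0 then e else d (Suc i)) Z"
    using exact_left_shift[OF Suc.prems(1)] .
  obtain j' where j: "j = Suc j'" "n \<le> j'" using Suc.prems(4) by (cases j) auto
  have "ext_vanishes C j' Z M"
    using Suc.IH[OF s(2) Suc.prems(2) _ j(2)] Suc.prems(3) by simp
  then show ?case using ext_vanishes_quotient[OF s(1)] Suc.prems(2) j(1) by blast
qed

text \<open>
  This is the converse shift: each kernel lowers the degree from which Ext vanishes by one, until
  it vanishes in all positive degrees.
\<close>

lemma exact_chain_ext_vanishes:
  assumes "exact_chain C n Y d" "\<And>i j. i < n \<Longrightarrow> ext_vanishes C j (Y (Suc i)) M"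
    "\<And>j. n \<le> j \<Longrightarrow> ext_vanishes C j (Y 0) M"
  shows "ext_vanishes C j (Y (Suc n)) M"
  using assms
proof (induction n arbitrary: Y d j)
  case 0
  then have "d 0 \<in> Hom C (Y (Suc 0)) (Y 0)" "monic C (d 0)" "epic C (d 0)"
    by (auto simp: exact_chain_def)
  then show ?case using ext_vanishes_iso 0(3) by blast
next
  case (Suc n)
  have d: "\<And>i. i \<le> Suc n \<Longrightarrow> d i \<in> Hom C (Y (Suc i)) (Y i)" "monic C (d (Suc n))"
    "\<And>i. i < Suc n \<Longrightarrow> exact_at C (d (Suc i)) (d i)" "epic C (d 0)"
    using Suc.prems(1) by (auto simp: exact_chain_def)
  have d0: "d 0 \<in> Hom C (Y 1) (Y 0)" and d1: "d 1 \<in> Hom C (Y 2) (Y 1)"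
    and ex: "exact_at C (d 1) (d 0)"
    using d(1)[of 0] d(1)[of 1] d(3)[of 0] by (simp_all add: numeral_2_eq_2)
  obtain Z m where s: "short_exact C Z m (Y 1) (d 0) (Y 0)"
    using epic_short_exact[OF d(4) d0] by blast
  then have m: "is_kernel C m (d 0)" "m \<in> Hom C Z (Y 1)" by (simp_all add: short_exact_iff)
  obtain e where e: "e \<in> Hom C (Y 2) Z" "epic C e" "m \<cdot> e = d 1"
    using exact_at_epic_part[OF ex d1 m] by auto
  have em: "monic C e" if "n = 0"
    using monic_cancel[OF e(1) m(2)] e(3) d(2) that by simp
  have ee: "exact_at C (d 2) e" if "0 < n"
    using exact_at_Cmp_monic[of "d 2" m e] d(3)[of 1] that e m(2) short_exactD(4)[OF s]
    by (simp add: numeral_2_eq_2)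
  have "exact_chain C n (\<lambda>i. if i = 0 then Z else Y (Suc i)) (\<lambda>i. if i = 0 then e else d (Suc i))"
    using d e(1,2) em ee by (auto simp: exact_chain_def numeral_2_eq_2)
  moreover have "ext_vanishes C j Z M" if "n \<le> j" for j
    using ext_vanishes_sub[OF s] Suc.prems(2)[of 0] Suc.prems(3)[of "Suc j"] that by simp
  moreover have "ext_vanishes C j (Y (Suc (Suc i))) M" if "i < n" for i j
    using Suc.prems(2)[of "Suc i"] that by simp
  ultimately show ?case
    using Suc.IH[of "\<lambda>i. if i = 0 then Z else Y (Suc i)"
      "\<lambda>i. if i = 0 then e else d (Suc i)"] by simp
qed

section \<open>Special precover classes\<close>

text \<open>
  The resolution is \<open>G\<close> itself in degree \<open>0\<close>, continued by a zero object.
\<close>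

lemma member_resolved_class:
  assumes G: "G \<in> \<F>" "\<F> \<subseteq> Obj C"
  shows "G \<in> resolved_class C \<F> \<alpha>"
proof -
  obtain Z where Z: "zero_object C Z" using has_zero_object by blast
  have O: "G \<in> Obj C" "Z \<in> Obj C" using G Z by (auto simp: zero_object_def)
  have ZG: "Zer C Z G \<in> Hom C Z G" "monic C (Zer C Z G)" and ZZ: "Zer C Z Z \<in> Hom C Z Z"
    "monic C (Zer C Z Z)" "epic C (Zer C Z Z)"
    using Zer_in_Hom O monic_from_zero[OF Z] epic_to_zero[OF Z] by blast+
  have I: "Idt C G \<in> Hom C G G" "epic C (Idt C G)" "monic C (Idt C G)"
    using Idt_in_Hom[OF O(1)] epicI_zero[OF Idt_in_Hom[OF O(1)]] monicI_zero[OF Idt_in_Hom[OF O(1)]]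
      Cmp_Idt_left Cmp_Idt_right by simp_all
  have s0: "short_exact C Z (Zer C Z G) G (Idt C G) G"
  proof (rule short_exactI[OF ZG(1) I(1) _ ZG(2) I(2)])
    show "Idt C G \<cdot> Zer C Z G = Zer C Z G" using Cmp_Idt_left ZG(1) .
    fix E g assume g: "g \<in> Hom C E G" "Idt C G \<cdot> g = Zer C E G"
    then have "g = Zer C E G" "E \<in> Obj C" using Cmp_Idt_left Hom_Obj by auto
    then show "\<exists>h \<in> Hom C E Z. Zer C Z G \<cdot> h = g"
      using O by (intro bexI[of _ "Zer C E Z"]) (simp_all add: arrow_simps)
  qed
  have s1: "short_exact C Z (Zer C Z Z) Z (Zer C Z Z) Z"
  proof (rule short_exactI[OF ZZ(1,1) _ ZZ(2,3)])
    show "Zer C Z Z \<cdot> Zer C Z Z = Zer C Z Z" using O by (simp add: arrow_simps)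
    fix E g assume g: "g \<in> Hom C E Z"
    then have "g = Zer C E Z" "E \<in> Obj C" using zero_object_Hom(2)[OF Z] Hom_Obj by auto
    then show "\<exists>h \<in> Hom C E Z. Zer C Z Z \<cdot> h = g"
      using O by (intro bexI[of _ "Zer C E Z"]) (simp_all add: arrow_simps)
  qed
  have ex: "exact_at C (Zer C Z G) (Idt C G)" "exact_at C (Zer C Z Z) (Zer C Z G)"
    "exact_at C (Zer C Z Z) (Zer C Z Z)"
    using exact_at_Cmp[OF s0 ZZ(1,3) I(1,3)] exact_at_Cmp[OF s1 ZZ(1,3) ZG] exact_at_Cmp[OF s1 ZZ(1,3) ZZ(1,2)]
      O by (simp_all add: arrow_simps)
  define X where "X = (\<lambda>i::nat. if i = 0 then G else Z)"
  define d where "d = (\<lambda>i::nat. if i = 0 then Idt C G else if i = 1 then Zer C Z G else Zer C Z Z)"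
  have "exact_left C X d G"
    using I(1,2) ZG(1) ZZ(1) ex by (auto simp: exact_left_def X_def d_def)
  moreover have "X i \<in> \<F> \<or> zero_object C (X i)" "enat i > \<alpha> \<Longrightarrow> zero_object C (X i)" for i
    using G(1) Z by (auto simp: X_def zero_enat_def[symmetric])
  ultimately show ?thesis using O(1) unfolding resolved_class_def by blast
qed

text \<open>
  The vanishing of \<open>Ext\<^sup>1\<close> splits a special precover of \<open>M\<close>, which exhibits \<open>M\<close> as a summand of a
  member.
\<close>

lemma special_precover_class_member:
  assumes F: "special_precover_class C \<F>" and M: "M \<in> Obj C"
    and v: "\<And>K. K \<in> right_perp C 1 \<F> \<Longrightarrow> ext_vanishes C 0 M K"
  shows "M \<in> \<F>"
proof -
  obtain K i G p where s: "short_exact C K i G p M" "G \<in> \<F>" "K \<in> right_perp C 1 \<F>"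
    using F M unfolding special_precover_class_def by metis
  have "biproduct C M K G" using short_exact_splits[OF s(1) v[OF s(3)]] .
  then show ?thesis using F s(2) unfolding special_precover_class_def by metis
qed

lemma projective_special_precover_class:
  assumes "special_precover_class C \<F>" "projective C P"
  shows "P \<in> \<F>"
  using special_precover_class_member[OF assms(1)] projective_ext_vanishes_0[OF assms(2)] assms(2)
  by (simp add: projective_def)

text \<open>
  A projective resolution is a resolution by members of the class.
\<close>

lemma resolved_class_infinity:
  assumes "special_precover_class C \<F>"
  shows "resolved_class C \<F> \<infinity> = Obj C"
proof -
  have "M \<in> resolved_class C \<F> \<infinity>" if M: "M \<in> Obj C" for M
  proof -
    obtain X d where "projective_resolution C M (X, d)"
      using exists_projective_resolution[OF M] by force
    then show ?thesis
      using M projective_special_precover_class[OF assms]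
      unfolding resolved_class_def projective_resolution_def by fastforce
  qed
  then show ?thesis unfolding resolved_class_def by blast
qed

lemma subset_double_perp:
  assumes "\<F> \<subseteq> Obj C" shows "\<F> \<subseteq> left_perp_inf C (right_perp_inf C \<F>)"
proof -
  have "right_perp_inf C \<F> \<subseteq> Obj C" using right_perp_inf_iff[OF assms] by blast
  then show ?thesis using left_perp_inf_iff right_perp_inf_iff[OF assms] assms by blast
qed

lemma homological_dimension_if_double_perp:
  assumes F: "special_precover_class C \<F>" and eq: "\<F> = left_perp_inf C (right_perp_inf C \<F>)"
  shows "defines_homological_dimension C \<F>"
proof -
  have FO: "\<F> \<subseteq> Obj C" using F by (simp add: special_precover_class_def)
  have RO: "right_perp_inf C \<F> \<subseteq> Obj C" using right_perp_inf_iff[OF FO] by blast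
  have "Y (Suc n) \<in> \<F>"
    if Y: "exact_chain C n Y d" "\<forall>i<n. Y (Suc i) \<in> \<F>" "Y 0 \<in> resolved_class C \<F> (enat n)" for n Y d
  proof -
    have "Y (Suc n) \<in> Obj C" using Y(1) Hom_Obj unfolding exact_chain_def by blast
    moreover have "ext_vanishes C j (Y (Suc n)) M" if M: "M \<in> right_perp_inf C \<F>" for M j
    proof -
      have F0: "ext_vanishes C j G M" if "G \<in> \<F>" for G j
        using right_perp_inf_iff[OF FO] M that by blast
      obtain X e where X: "exact_left C X e (Y 0)" "\<And>i. X i \<in> \<F> \<or> zero_object C (X i)"
        "\<And>i. n < i \<Longrightarrow> zero_object C (X i)"
        using Y(3) unfolding resolved_class_def by auto
      have "X i \<in> \<F>" for i
        using X(2) zero_object_projective projective_special_precover_class[OF F] by blast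
      then have "ext_vanishes C j (Y 0) M" if "n \<le> j" for j
        using resolution_ext_vanishes[OF X(1) _ X(3) that] F0 by blast
      then show ?thesis using exact_chain_ext_vanishes[OF Y(1)] F0 Y(2) by blast
    qed
    ultimately show ?thesis using left_perp_inf_iff[OF RO] eq by blast
  qed
  moreover have "K \<in> resolved_class C \<F> \<infinity>" if "short_exact C K i G p M" for K i G p M
    using short_exact_Obj[OF that] resolved_class_infinity[OF F] by blast
  ultimately show ?thesis unfolding defines_homological_dimension_def by blast
qed

text \<open>
  The sequence is read as a chain with \<open>n = 1\<close>, where \<open>G\<close> has the resolution of length \<open>0\<close>.
\<close>

lemma syzygy_in_class:
  assumes D: "defines_homological_dimension C \<F>" and FO: "\<F> \<subseteq> Obj C"
    and s: "short_exact C K k P p G" and PG: "P \<in> \<F>" "G \<in> \<F>"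
  shows "K \<in> \<F>"
proof -
  define Y where "Y = (\<lambda>i::nat. if i = 0 then G else if i = 1 then P else K)"
  define d where "d = (\<lambda>i::nat. if i = 0 then p else k)"
  have "exact_chain C (Suc 0) Y d"
    using s short_exactD(1,2)[OF s] by (auto simp: exact_chain_def Y_def d_def short_exact_def le_Suc_eq)
  moreover have "Y 0 \<in> resolved_class C \<F> (enat (Suc 0))"
    using member_resolved_class[OF PG(2) FO] by (simp add: Y_def)
  moreover have "\<forall>i < Suc 0. Y (Suc i) \<in> \<F>" using PG(1) by (simp add: Y_def)
  ultimately have "Y (Suc (Suc 0)) \<in> \<F>"
    using conjunct2[OF D[unfolded defines_homological_dimension_def], rule_format, of "Suc 0" Y d]
    by blast
  then show ?thesis by (simp add: Y_def)
qed

lemma double_perp_if_homological_dimension: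
  assumes F: "special_precover_class C \<F>" and D: "defines_homological_dimension C \<F>"
  shows "\<F> = left_perp_inf C (right_perp_inf C \<F>)"
proof
  have FO: "\<F> \<subseteq> Obj C" using F by (simp add: special_precover_class_def)
  show "\<F> \<subseteq> left_perp_inf C (right_perp_inf C \<F>)" using subset_double_perp[OF FO] .
  have RO: "right_perp_inf C \<F> \<subseteq> Obj C" using right_perp_inf_iff[OF FO] by blast
  \<comment> \<open>Orthogonality in degree one propagates to all degrees, since the syzygies stay in the class.\<close>
  have vanish: "ext_vanishes C n G M" if M: "M \<in> right_perp C 1 \<F>" and G: "G \<in> \<F>" for n G M
    using G
  proof (induction n arbitrary: G)
    case 0
    then show ?case using M right_perp_1_iff[OF FO] by blast
  next
    case (Suc n)
    have "G \<in> Obj C" using Suc.prems FO by blast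
    then obtain K k P p where P: "projective C P" "short_exact C K k P p G"
      using projective_cover by metis
    have "K \<in> \<F>"
      using syzygy_in_class[OF D FO P(2) projective_special_precover_class[OF F P(1)] Suc.prems] .
    then show ?case using Suc.IH ext_vanishes_Suc_iff[OF P(2,1)] by blast
  qed
  have sub: "right_perp C 1 \<F> \<subseteq> right_perp_inf C \<F>"
    using vanish right_perp_inf_iff[OF FO] right_perp_1_iff[OF FO] by blast
  show "left_perp_inf C (right_perp_inf C \<F>) \<subseteq> \<F>"
  proof
    fix M assume M: "M \<in> left_perp_inf C (right_perp_inf C \<F>)"
    then have "M \<in> Obj C" "\<And>K. K \<in> right_perp C 1 \<F> \<Longrightarrow> ext_vanishes C 0 M K"
      using left_perp_inf_iff[OF RO] sub by blast+
    then show "M \<in> \<F>" using special_precover_class_member[OF F] by blast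
  qed
qed

end

theorem theorem1p16:
  fixes C :: "('o, 'm) preadd_cat" and \<F> :: "'o set"
  assumes "abelian_category C"
    and "enough_projectives C"
    and "special_precover_class C \<F>"
  shows "defines_homological_dimension C \<F> \<longleftrightarrow> \<F> = left_perp_inf C (right_perp_inf C \<F>)"
proof -
  interpret abelian_category_enough_projectives C
    using assms(1,2)
    by (simp add: abelian_category_enough_projectives_def abelian_category_enough_projectives_axioms_def)
  show ?thesis
    using homological_dimension_if_double_perp[OF assms(3)]
      double_perp_if_homological_dimension[OF assms(3)] by blast
qed

end
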